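(* Let $G=(V,D,B)$ be a directed mixed graph (possibly cyclic), let $W\subseteq V$ be HTC-identified with witness sets $(Y_u)_{u\in W}$ and HTC ordering $\prec$, and let $P_0=P_{(\beta,\varepsilon)}\in\mathcal{M}_G$ be the true distribution, at which $A_u$ is invertible for every $u\in W$. Let $v\in W$ with $\mathrm{pa}(v)=\{p_1,\dots,p_k\}$ and $Y_v=\{y_1,\dots,y_k\}$. Then $$\phi_{\beta_v}=A_v^{-1}R_v$$ is an influence function for $\beta_v$ in $\mathcal{M}_G$ at $P_0$. That is, $\phi_{\beta_v}$ has mean zero, is square-integrable under $P_0$, and for every parametric path $\gamma\mapsto P_\gamma=P_{(\beta_\gamma,\varepsilon_\gamma)}\in\mathcal{M}_G$ through $P_0$ (with $(\beta_\gamma,\varepsilon_\gamma)=(\beta,\varepsilon)$ at $\gamma=0$) that is differentiable in quadratic mean at $\gamma=0$ with score $S$, $$\mathrm{E}[\phi_{\beta_v}S]=\frac{d}{d\gamma}\Big|_{\gamma=0}\beta_{v,\gamma}.$$ For the edge $p_j\to v$ this yields the influence function $\phi_{\beta_{p_jv}}=e_j^{\top}A_v^{-1}R_v$, where $e_j$ is the $j$-th standard basis vector.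
   Context: Graphs. A directed mixed graph $G=(V,D,B)$ has a finite vertex set $V$, directed edges $D\subseteq V^2$ (written $v\to w$) and bidirected edges $B\subseteq\binom V2$ (written $v\leftrightarrow w$), with no self-loops; directed cycles are allowed. $\mathrm{pa}(v)=\{w:w\to v\in D\}$, $\mathrm{sib}(v)=\{w:w\leftrightarrow v\in B\}$, and for $U\subseteq V$, $\mathrm{sib}(U)=\{v\in V\setminus U: v\leftrightarrow w\in B\text{ for some }w\in U\}$. A half-trek is a path $\pi$ of the form $v_0\to v_1\to\cdots\to v_\ell$ or $v_0\leftrightarrow v_1\to\cdots\to v_\ell$, with $\mathrm{Left}(\pi)=\{v_0\}$, $\mathrm{Right}(\pi)=\{v_1,\dots,v_\ell\}$. $\mathrm{htr}(v)$ is the set of $w\in V\setminus(\{v\}\cup\mathrm{sib}(v))$ such that there is a half-trek from $v$ to $w$. A system of half-treks has no sided intersection if $\mathrm{Left}(\pi_i)\cap\mathrm{Left}(\pi_j)=\emptyset=\mathrm{Right}(\pi_i)\cap\mathrm{Right}(\pi_j)$ for all $i\ne j$. Half-trek criterion (HTC). $Y\subset V$ satisfies the HTC for $v$ if (i) $|Y|=|\mathrm{pa}(v)|$; (ii) $Y\cap(\{v\}\cup\mathrm{sib}(v))=\emptyset$; (iii) there is a system of half-treks from $Y$ to $\mathrm{pa}(v)$ with no sided intersection. $W\subseteq V$ is HTC-identified with witness sets $(Y_u)_{u\in W}$ and HTC ordering $\prec$ (a total order on $W$) if $Y_u$ satisfies the HTC for $u$ for each $u\in W$, and $w\prec u$ (in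 particular $w\in W$) whenever $w\in Y_u\cap\mathrm{htr}(u)$. Model. $\mathcal{B}$ is the set of $\beta\in\mathbb{R}^{|V|\times|V|}$ with $\beta_{wv}=0$ whenever $w\to v\notin D$ and $\det(I-\beta)\neq0$. $\mathcal{E}$ is the set of mean-zero $\mathbb{R}^{|V|}$-valued random vectors $\varepsilon$ with finite fourth moment such that $\varepsilon_U$ is independent of $\varepsilon_{V\setminus(U\cup\mathrm{sib}(U))}$ for every $U\subseteq V$ connected in $(V,B)$. $P_{(\beta,\varepsilon)}$ is the distribution of $X=(I-\beta)^{-\top}\varepsilon$, the solution of $X=\beta^\top X+\varepsilon$, and $\mathcal{M}_G=\{P_{(\beta,\varepsilon)}:\beta\in\mathcal{B},\varepsilon\in\mathcal{E}\}$. Expectations $\mathrm{E}$ are under $P_0$; $\varepsilon_v=X_v-\beta_v^\top X_{\mathrm{pa}(v)}$ is regarded as a function of $X$; $\beta_v=(\beta_{p_1v},\dots,\beta_{p_kv})^\top$ for $\mathrm{pa}(v)=\{p_1,\dots,p_k\}$. Instruments. For $v\in W$ and $y\in Y_v$: $Z_y=\varepsilon_y=X_y-\beta_y^\top X_{\mathrm{pa}(y)}$ if $y\in\mathrm{htr}(v)$ and $Z_y=X_y$ if $y\notin\mathrm{htr}(v)$. $A_v=\mathrm{E}[Z_{Y_v}X_{\mathrm{pa}(v)}^\top]$. Row contributions, defined recursively along $\prec$ together with $\phi_{\beta_u}=A_u^{-1}R_u$ for $u\in W$ (its entry for the edge $q\to u$ is denoted $\phi_{\beta_{qu}}$): $R_v=(R_{y_1,v},\dots,R_{y_k,v})^\top$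 with $$R_{y,v}=\begin{cases}X_y\varepsilon_v,& y\notin\mathrm{htr}(v),\\ \varepsilon_y\varepsilon_v-\sum_{q\in\mathrm{pa}(y)}\mathrm{E}[X_q\varepsilon_v]\,\phi_{\beta_{qy}},& y\in\mathrm{htr}(v).\end{cases}$$ Paths. $\gamma\mapsto P_\gamma$ is differentiable in quadratic mean at $\gamma=0$ with score $S$ (mean zero, square-integrable under $P_0$) if $\int\big(\gamma^{-1}(dP_\gamma^{1/2}-dP_0^{1/2})-\tfrac12 S\,dP_0^{1/2}\big)^2\to0$ as $\gamma\to0$. *)

theory Defs
  imports "HOL-Probability.Probability"
begin

text \<open>The vertex set is the (finite) type \<open>'v\<close>. Bidirected edges are unordered pairs.\<close>

record 'v mixed_graph =
  directed :: "('v \<times> 'v) set"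
  bidirected :: "'v set set"

definition directed_mixed_graph :: "'v mixed_graph \<Rightarrow> bool" where
  "directed_mixed_graph G \<longleftrightarrow>
     (\<forall>v. (v, v) \<notin> directed G) \<and> (\<forall>e\<in>bidirected G. card e = 2)"

definition pa :: "'v mixed_graph \<Rightarrow> 'v \<Rightarrow> 'v set" where
  "pa G v = {w. (w, v) \<in> directed G}"

definition sib :: "'v mixed_graph \<Rightarrow> 'v \<Rightarrow> 'v set" where
  "sib G v = {w. {w, v} \<in> bidirected G}"

definition sib_set :: "'v mixed_graph \<Rightarrow> 'v set \<Rightarrow> 'v set" where
  "sib_set G U = {v. v \<notin> U \<and> (\<exists>w\<in>U. {v, w} \<in> bidirected G)}"

text \<open>A half-trek is given by its vertex sequence; vertices may repeat. A sequence \<open>v0, v1, \<dots>\<close>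
  that is a half-trek both via a directed and via a bidirected first edge has the same left and
  right sides either way, so the kind of the first edge is not recorded.\<close>

definition half_trek :: "'v mixed_graph \<Rightarrow> 'v list \<Rightarrow> bool" where
  "half_trek G xs \<longleftrightarrow>
     xs \<noteq> [] \<and>
     (successively (\<lambda>a b. (a, b) \<in> directed G) xs \<or>
      (\<exists>v0 v1 zs. xs = v0 # v1 # zs \<and> {v0, v1} \<in> bidirected G \<and>
         successively (\<lambda>a b. (a, b) \<in> directed G) (v1 # zs)))"

definition left_side :: "'v list \<Rightarrow> 'v set" where
  "left_side xs = {hd xs}"

definition right_side :: "'v list \<Rightarrow> 'v set" where
  "right_side xs = set (tl xs)"

definition htr :: "'v mixed_graph \<Rightarrow> 'v \<Rightarrow> 'v set" where
  "htr G v = {w. w \<notin> insert v (sib G v) \<and> (\<exists>xs. half_trek G xs \<and> hd xs = v \<and> last xs = w)}"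

text \<open>Systems of half-treks are indexed by their sources.\<close>

definition half_trek_system :: "'v mixed_graph \<Rightarrow> 'v set \<Rightarrow> 'v set \<Rightarrow> ('v \<Rightarrow> 'v list) \<Rightarrow> bool" where
  "half_trek_system G Y T \<pi> \<longleftrightarrow>
     (\<forall>y\<in>Y. half_trek G (\<pi> y) \<and> hd (\<pi> y) = y) \<and> bij_betw (\<lambda>y. last (\<pi> y)) Y T"

definition no_sided_intersection :: "'v set \<Rightarrow> ('v \<Rightarrow> 'v list) \<Rightarrow> bool" where
  "no_sided_intersection Y \<pi> \<longleftrightarrow>
     (\<forall>y\<in>Y. \<forall>y'\<in>Y. y \<noteq> y' \<longrightarrow>
        left_side (\<pi> y) \<inter> left_side (\<pi> y') = {} \<and>
        right_side (\<pi> y) \<inter> right_side (\<pi> y') = {})"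

definition htc :: "'v mixed_graph \<Rightarrow> 'v \<Rightarrow> 'v set \<Rightarrow> bool" where
  "htc G v Y \<longleftrightarrow>
     card Y = card (pa G v) \<and>
     Y \<inter> insert v (sib G v) = {} \<and>
     (\<exists>\<pi>. half_trek_system G Y (pa G v) \<pi> \<and> no_sided_intersection Y \<pi>)"

definition htc_identified ::
  "'v mixed_graph \<Rightarrow> 'v set \<Rightarrow> ('v \<Rightarrow> 'v set) \<Rightarrow> 'v rel \<Rightarrow> bool" where
  "htc_identified G W Y prec \<longleftrightarrow>
     prec \<subseteq> W \<times> W \<and> strict_linear_order_on W prec \<and>
     (\<forall>u\<in>W. htc G u (Y u) \<and> (\<forall>w \<in> Y u \<inter> htr G u. w \<in> W \<and> (w, u) \<in> prec))"

text \<open>The coefficient of the edge \<open>w \<rightarrow> v\<close> is \<open>\<beta> $ w $ v\<close>.\<close>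

definition coeff_matrices :: "'v::finite mixed_graph \<Rightarrow> (real^'v^'v) set" where
  "coeff_matrices G =
     {\<beta>. (\<forall>w v. (w, v) \<notin> directed G \<longrightarrow> \<beta> $ w $ v = 0) \<and> det (mat 1 - \<beta>) \<noteq> 0}"

text \<open>Connectedness of the subgraph of the bidirected part induced by \<open>U\<close>.\<close>

definition bidir_connected :: "'v mixed_graph \<Rightarrow> 'v set \<Rightarrow> bool" where
  "bidir_connected G U \<longleftrightarrow>
     (\<forall>a\<in>U. \<forall>b\<in>U. (a, b) \<in> {(a, b). a \<in> U \<and> b \<in> U \<and> {a, b} \<in> bidirected G}\<^sup>*)"

text \<open>An error vector enters the model only through its law \<open>N\<close>; it is realised here as the identity
  on \<open>N\<close>.\<close>

definition error_law :: "'v::finite mixed_graph \<Rightarrow> (real^'v) measure \<Rightarrow> bool" where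
  "error_law G N \<longleftrightarrow>
     prob_space N \<and> sets N = sets borel \<and>
     (\<forall>v. integrable N (\<lambda>e. (e $ v) ^ 4)) \<and>
     (\<forall>v. (LINT e|N. e $ v) = 0) \<and>
     (\<forall>U. bidir_connected G U \<longrightarrow>
        prob_space.indep_var N
          (PiM U (\<lambda>_. borel)) (\<lambda>e. \<lambda>i\<in>U. e $ i)
          (PiM (- (U \<union> sib_set G U)) (\<lambda>_. borel)) (\<lambda>e. \<lambda>i\<in>- (U \<union> sib_set G U). e $ i))"

definition model_dist :: "real^'v^'v \<Rightarrow> (real^'v) measure \<Rightarrow> (real^'v::finite) measure" where
  "model_dist \<beta> N = distr N borel (\<lambda>e. matrix_inv (transpose (mat 1 - \<beta>)) *v e)"

definition square_integrable :: "'a measure \<Rightarrow> ('a \<Rightarrow> 'b::euclidean_space) \<Rightarrow> bool" where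
  "square_integrable M f \<longleftrightarrow> f \<in> borel_measurable M \<and> integrable M (\<lambda>x. (norm (f x))\<^sup>2)"

text \<open>The densities \<open>p \<gamma>\<close> of \<open>P \<gamma>\<close> and \<open>q \<gamma>\<close> of \<open>P 0\<close> are taken with respect to a common
  dominating measure \<open>\<mu> \<gamma>\<close> (for instance the sum of \<open>P \<gamma>\<close> and \<open>P 0\<close>), which may
  depend on \<open>\<gamma>\<close>; the value of the integral does not depend on its choice.\<close>

definition qmd_with_score :: "(real \<Rightarrow> 'a measure) \<Rightarrow> ('a \<Rightarrow> real) \<Rightarrow> bool" where
  "qmd_with_score P S \<longleftrightarrow>
     square_integrable (P 0) S \<and> (LINT x|P 0. S x) = 0 \<and>
     (\<exists>\<mu> p q.
        (\<forall>\<^sub>F \<gamma> in at 0.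
           sigma_finite_measure (\<mu> \<gamma>) \<and>
           p \<gamma> \<in> borel_measurable (\<mu> \<gamma>) \<and> (\<forall>x. 0 \<le> p \<gamma> x) \<and>
           q \<gamma> \<in> borel_measurable (\<mu> \<gamma>) \<and> (\<forall>x. 0 \<le> q \<gamma> x) \<and>
           P \<gamma> = density (\<mu> \<gamma>) (\<lambda>x. ennreal (p \<gamma> x)) \<and>
           P 0 = density (\<mu> \<gamma>) (\<lambda>x. ennreal (q \<gamma> x))) \<and>
        ((\<lambda>\<gamma>. \<integral>\<^sup>+x. ennreal
             (((sqrt (p \<gamma> x) - sqrt (q \<gamma> x)) / \<gamma> - 1 / 2 * S x * sqrt (q \<gamma> x))\<^sup>2) \<partial>\<mu> \<gamma>)
           \<longlongrightarrow> 0) (at 0))"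

definition model_path ::
  "'v::finite mixed_graph \<Rightarrow> real^'v^'v \<Rightarrow> (real^'v) measure \<Rightarrow>
   (real \<Rightarrow> real^'v^'v) \<Rightarrow> (real \<Rightarrow> (real^'v) measure) \<Rightarrow> bool" where
  "model_path G \<beta> N \<beta>s Ns \<longleftrightarrow>
     \<beta>s 0 = \<beta> \<and> Ns 0 = N \<and>
     (\<forall>\<^sub>F \<gamma> in nhds 0. \<beta>s \<gamma> \<in> coeff_matrices G \<and> error_law G (Ns \<gamma>))"

text \<open>\<open>\<phi>\<close> is an influence function for the functional \<open>\<psi>\<close> of the coefficient matrix, at the law given
  by \<open>\<beta>\<close> and \<open>N\<close>. Differentiability of \<open>\<psi>\<close> along each path is part of the claim.\<close>

definition influence_function ::
  "'v::finite mixed_graph \<Rightarrow> real^'v^'v \<Rightarrow> (real^'v) measure \<Rightarrow>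
   (real^'v^'v \<Rightarrow> 'b::euclidean_space) \<Rightarrow> (real^'v \<Rightarrow> 'b) \<Rightarrow> bool" where
  "influence_function G \<beta> N \<psi> \<phi> \<longleftrightarrow>
     has_bochner_integral (model_dist \<beta> N) \<phi> 0 \<and>
     square_integrable (model_dist \<beta> N) \<phi> \<and>
     (\<forall>\<beta>s Ns S.
        model_path G \<beta> N \<beta>s Ns \<and> qmd_with_score (\<lambda>\<gamma>. model_dist (\<beta>s \<gamma>) (Ns \<gamma>)) S \<longrightarrow>
        ((\<lambda>\<gamma>. \<psi> (\<beta>s \<gamma>)) has_vector_derivative
           (LINT x|model_dist \<beta> N. S x *\<^sub>R \<phi> x)) (at 0))"

text \<open>Matrices with rows indexed by a finite set \<open>I\<close> and columns by a finite set \<open>J\<close>; the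
  definitions follow those of \<open>invertible\<close> and \<open>matrix_inv\<close>. Indexing by sets makes any
  enumeration of parents and witnesses unnecessary.\<close>

definition inverse_pair_on ::
  "'i set \<Rightarrow> 'j set \<Rightarrow> ('i \<Rightarrow> 'j \<Rightarrow> real) \<Rightarrow> ('j \<Rightarrow> 'i \<Rightarrow> real) \<Rightarrow> bool" where
  "inverse_pair_on I J A B \<longleftrightarrow>
     (\<forall>i\<in>I. \<forall>i'\<in>I. (\<Sum>j\<in>J. A i j * B j i') = (if i = i' then 1 else 0)) \<and>
     (\<forall>j\<in>J. \<forall>j'\<in>J. (\<Sum>i\<in>I. B j i * A i j') = (if j = j' then 1 else 0))"

definition invertible_on :: "'i set \<Rightarrow> 'j set \<Rightarrow> ('i \<Rightarrow> 'j \<Rightarrow> real) \<Rightarrow> bool" where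
  "invertible_on I J A \<longleftrightarrow> (\<exists>B. inverse_pair_on I J A B)"

definition matrix_inv_on :: "'i set \<Rightarrow> 'j set \<Rightarrow> ('i \<Rightarrow> 'j \<Rightarrow> real) \<Rightarrow> 'j \<Rightarrow> 'i \<Rightarrow> real" where
  "matrix_inv_on I J A = (SOME B. inverse_pair_on I J A B)"

definition eps :: "'v::finite mixed_graph \<Rightarrow> real^'v^'v \<Rightarrow> 'v \<Rightarrow> real^'v \<Rightarrow> real" where
  "eps G \<beta> v x = x $ v - (\<Sum>w\<in>pa G v. \<beta> $ w $ v * x $ w)"

definition instrument ::
  "'v::finite mixed_graph \<Rightarrow> real^'v^'v \<Rightarrow> 'v \<Rightarrow> 'v \<Rightarrow> real^'v \<Rightarrow> real" where
  "instrument G \<beta> v y x = (if y \<in> htr G v then eps G \<beta> y x else x $ y)"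

definition A_mat ::
  "'v::finite mixed_graph \<Rightarrow> real^'v^'v \<Rightarrow> (real^'v) measure \<Rightarrow> 'v \<Rightarrow> 'v \<Rightarrow> 'v \<Rightarrow> real" where
  "A_mat G \<beta> P v y p = (LINT x|P. instrument G \<beta> v y x * x $ p)"

text \<open>One step of the recursion: \<open>row_step G \<beta> P \<phi> v y\<close> is the contribution of \<open>y\<close> to the row for
  \<open>v\<close>, where \<open>\<phi> u q\<close> stands for the influence function of the edge \<open>q \<rightarrow> u\<close>.\<close>

definition row_step ::
  "'v::finite mixed_graph \<Rightarrow> real^'v^'v \<Rightarrow> (real^'v) measure \<Rightarrow> ('v \<Rightarrow> 'v \<Rightarrow> real^'v \<Rightarrow> real) \<Rightarrow>
   'v \<Rightarrow> 'v \<Rightarrow> real^'v \<Rightarrow> real" where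
  "row_step G \<beta> P \<phi> v y x =
     (if y \<notin> htr G v then x $ y * eps G \<beta> v x
      else eps G \<beta> y x * eps G \<beta> v x
           - (\<Sum>q\<in>pa G y. (LINT x'|P. x' $ q * eps G \<beta> v x') * \<phi> y q x))"

definition edge_infl ::
  "'v::finite mixed_graph \<Rightarrow> ('v \<Rightarrow> 'v set) \<Rightarrow> 'v rel \<Rightarrow> real^'v^'v \<Rightarrow> (real^'v) measure \<Rightarrow>
   'v \<Rightarrow> 'v \<Rightarrow> real^'v \<Rightarrow> real" where
  "edge_infl G Y prec \<beta> P =
     wfrec prec (\<lambda>\<phi> v p x.
       \<Sum>y\<in>Y v. matrix_inv_on (Y v) (pa G v) (A_mat G \<beta> P v) p y * row_step G \<beta> P \<phi> v y x)"

definition row_contrib ::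
  "'v::finite mixed_graph \<Rightarrow> ('v \<Rightarrow> 'v set) \<Rightarrow> 'v rel \<Rightarrow> real^'v^'v \<Rightarrow> (real^'v) measure \<Rightarrow>
   'v \<Rightarrow> 'v \<Rightarrow> real^'v \<Rightarrow> real" where
  "row_contrib G Y prec \<beta> P = row_step G \<beta> P (edge_infl G Y prec \<beta> P)"

lemma edge_infl_rec:
  fixes G :: "'v::finite mixed_graph"
  assumes "htc_identified G W Y prec" "v \<in> W"
  shows "edge_infl G Y prec \<beta> P v p x =
    (\<Sum>y\<in>Y v. matrix_inv_on (Y v) (pa G v) (A_mat G \<beta> P v) p y * row_contrib G Y prec \<beta> P v y x)"
proof -
  have ord: "trans prec" "irrefl prec"
    and step: "\<And>y. y \<in> Y v \<Longrightarrow> y \<in> htr G v \<Longrightarrow> (y, v) \<in> prec"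
    using assms by (auto simp: htc_identified_def strict_linear_order_on_def)
  have "acyclic prec"
    using ord by (simp add: acyclic_irrefl)
  then have wf: "wf prec"
    by (intro finite_acyclic_wf) auto
  show ?thesis
    unfolding edge_infl_def row_contrib_def
    by (subst wfrec[OF wf]) (auto intro!: sum.cong simp: row_step_def cut_apply step)
qed

end

theory Submission
  imports Defs "HOL-Library.Landau_Symbols"
begin

text \<open>Along a path only the existence of fourth moments is assumed, not their boundedness, so second
  moments need not be differentiable in \<open>\<gamma>\<close> and the moment equations cannot be differentiated
  directly. Expectations of bounded functions, however, do expand to first order by
  differentiability in quadratic mean. At every law of the model the instrument \<open>Z\<close> of a witness is
  independent of the error \<open>\<epsilon>\<close> of \<open>v\<close>, so the covariance of \<open>sin (\<tau> Z) / \<tau>\<close> and \<open>sin (\<tau> \<epsilon>) / \<tau>\<close> vanishes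
  for all \<open>\<tau>\<close>. Expanding it for fixed \<open>\<tau>\<close> and then letting \<open>\<tau>\<close> tend to 0 gives a linear equation for the
  increment \<open>\<Delta>\<close> of \<open>\<beta>\<^sub>v\<close>. As the coefficients along the path are not assumed continuous, the error is
  scaled by \<open>1 / (1 + norm \<Delta>)\<close>; continuity of \<open>\<beta>\<^sub>v\<close> then comes out together with its derivative.\<close>

section \<open>Expansion of bounded expectations\<close>

text \<open>Let \<open>z\<close> and \<open>h\<close> be the coefficient vectors of instrument and
  error at \<open>\<gamma> = 0\<close>; along the path they become \<open>z - \<delta>\<close> and
  \<open>h - \<Delta>\<close>. At the law for \<open>\<gamma>\<close> only boundedness and
  factorization are used; the shifted forms are then expanded under the fixed law at 0, whose
  moments are constants. To first order this reads \<open>\<gamma> *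
  E[(z \<bullet> x) * (h \<bullet> x) * S] = E[(\<delta> \<bullet> x) * (h \<bullet> x)] +
  E[(z \<bullet> x) * (\<Delta> \<bullet> x)]\<close>. The last term is a row of the matrix A
  applied to the increment of the coefficients of v. The vector \<open>\<delta>\<close> is nonzero
  only if the instrument is itself an error, of some y preceding v; it is then the increment of the
  coefficients of y. Induction along the ordering replaces it by \<open>\<gamma>\<close> times its
  derivative, and this is the origin of the subtracted sum in the row contributions. Fourth moments
  of X and a square-integrable score control only two powers of X times S. The truncation error in
  the score term therefore has no rate in \<open>\<tau>\<close>; it vanishes by dominated
  convergence.\<close>

lemma qmd_remainder_bound:
  fixes p q S g :: "'a \<Rightarrow> real"
  defines "r \<equiv> \<lambda>\<gamma> x. (sqrt (p x) - sqrt (q x)) / \<gamma> - 1 / 2 * S x * sqrt (q x)"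
  assumes [measurable]: "p \<in> borel_measurable \<mu>" "q \<in> borel_measurable \<mu>"
      "S \<in> borel_measurable \<mu>" "g \<in> borel_measurable \<mu>"
    and nonneg: "\<And>x. 0 \<le> p x" "\<And>x. 0 \<le> q x"
    and prob: "prob_space (density \<mu> q)"
    and S2: "integrable (density \<mu> q) (\<lambda>x. (S x)\<^sup>2)"
    and rem: "(\<integral>\<^sup>+x. ennreal ((r \<gamma> x)\<^sup>2) \<partial>\<mu>) \<le> ennreal \<rho>"
    and pos: "\<gamma> \<noteq> 0" "0 < \<eta>" "0 \<le> \<rho>"
    and bnd: "\<And>x. \<bar>g x\<bar> \<le> C"
  shows "\<bar>(LINT x|density \<mu> p. g x) - (LINT x|density \<mu> q. g x)
           - \<gamma> * (LINT x|density \<mu> q. g x * S x)\<bar>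
         \<le> C * \<bar>\<gamma>\<bar> * (\<eta> + \<rho> / \<eta> + 2 * \<bar>\<gamma>\<bar> * (\<rho> + (LINT x|density \<mu> q. (S x)\<^sup>2) / 4))"
proof -
  interpret Q: prob_space "density \<mu> q" by fact
  have [measurable]: "r \<gamma> \<in> borel_measurable \<mu>" unfolding r_def by measurable
  have C0: "0 \<le> C" using bnd[of undefined] by linarith
  have r2: "integrable \<mu> (\<lambda>x. (r \<gamma> x)\<^sup>2)"
    using le_less_trans[OF rem ennreal_less_top] by (intro integrableI_bounded) auto
  have r2_le: "(LINT x|\<mu>. (r \<gamma> x)\<^sup>2) \<le> \<rho>"
    using rem pos(3) by (simp add: nn_integral_eq_integral[OF r2])
  have q_int: "integrable \<mu> q"
    using Q.integrable_const[of "1::real"] integrable_density[of "\<lambda>_. 1::real" \<mu> q]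
    by (simp add: nonneg)
  have q_one: "(LINT x|\<mu>. q x) = 1"
    using Q.prob_space integral_density[of "\<lambda>_. 1::real" \<mu> q] by (simp add: nonneg)
  have S2q: "integrable \<mu> (\<lambda>x. (S x)\<^sup>2 * q x)"
    using S2 by (subst (asm) integrable_density) (auto simp: nonneg mult.commute)
  have S2q_eq: "(LINT x|\<mu>. (S x)\<^sup>2 * q x) = (LINT x|density \<mu> q. (S x)\<^sup>2)"
    by (subst integral_density) (auto simp: nonneg mult.commute)
  let ?h = "\<lambda>x. \<bar>\<gamma>\<bar> * (\<eta> * q x + (r \<gamma> x)\<^sup>2 / \<eta>) + 2 * \<gamma>\<^sup>2 * ((r \<gamma> x)\<^sup>2 + (S x)\<^sup>2 * q x / 4)"
  have h_int: "integrable \<mu> ?h" using r2 q_int S2q by simp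
  \<comment> \<open>With \<open>sqrt (p x) = t + \<gamma> * w\<close> the densities differ by
    \<open>2 * \<gamma> * t * w + \<gamma>\<^sup>2 * w\<^sup>2\<close>, and the part of
    \<open>w\<close> that carries \<open>S\<close> gives exactly the score term. The remaining cross
    term is split by \<open>2 * a * b \<le> \<eta> * a\<^sup>2 + b\<^sup>2 / \<eta>\<close>, which
    needs only the integrals of \<open>q\<close> and of the squared remainder.\<close>
  have key: "\<bar>p x - q x - \<gamma> * S x * q x\<bar> \<le> ?h x" for x
  proof -
    define t where "t = sqrt (q x)"
    define w where "w = r \<gamma> x + S x * t / 2"
    have t2: "q x = t\<^sup>2" using nonneg by (simp add: t_def)
    have "sqrt (p x) = t + \<gamma> * w" using pos(1) by (simp add: w_def r_def t_def field_simps)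
    then have p2: "p x = (t + \<gamma> * w)\<^sup>2" using nonneg by (metis real_sqrt_pow2)
    have eq: "p x - q x - \<gamma> * S x * q x = \<gamma> * (2 * r \<gamma> x * t) + \<gamma>\<^sup>2 * w\<^sup>2"
      unfolding p2 t2 w_def by (simp add: power2_eq_square algebra_simps)
    have "0 \<le> (\<eta> * \<bar>t\<bar> - \<bar>r \<gamma> x\<bar>)\<^sup>2 / \<eta>" using pos by simp
    then have a: "\<bar>2 * r \<gamma> x * t\<bar> \<le> \<eta> * t\<^sup>2 + (r \<gamma> x)\<^sup>2 / \<eta>"
      using pos by (simp add: power2_eq_square field_simps abs_mult)
    have "0 \<le> (r \<gamma> x - S x * t / 2)\<^sup>2" by simp
    then have b: "w\<^sup>2 \<le> 2 * ((r \<gamma> x)\<^sup>2 + (S x)\<^sup>2 * t\<^sup>2 / 4)"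
      unfolding w_def by (simp add: power2_eq_square field_simps)
    have "\<bar>\<gamma> * (2 * r \<gamma> x * t) + \<gamma>\<^sup>2 * w\<^sup>2\<bar> \<le> \<bar>\<gamma>\<bar> * \<bar>2 * r \<gamma> x * t\<bar> + \<gamma>\<^sup>2 * w\<^sup>2"
      by (rule order_trans[OF abs_triangle_ineq]) (simp add: abs_mult)
    also have "\<dots> \<le> \<bar>\<gamma>\<bar> * (\<eta> * t\<^sup>2 + (r \<gamma> x)\<^sup>2 / \<eta>) + \<gamma>\<^sup>2 * (2 * ((r \<gamma> x)\<^sup>2 + (S x)\<^sup>2 * t\<^sup>2 / 4))"
      using a b by (intro add_mono mult_left_mono) auto
    also have "\<dots> = \<bar>\<gamma>\<bar> * (\<eta> * t\<^sup>2 + (r \<gamma> x)\<^sup>2 / \<eta>) + 2 * \<gamma>\<^sup>2 * ((r \<gamma> x)\<^sup>2 + (S x)\<^sup>2 * t\<^sup>2 / 4)"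
      by simp
    finally show ?thesis unfolding eq[symmetric] unfolding t2 .
  qed
  have d_int: "integrable \<mu> (\<lambda>x. p x - q x - \<gamma> * S x * q x)"
    by (rule Bochner_Integration.integrable_bound[OF h_int])
       (use key in \<open>auto intro!: always_eventually order_trans[OF _ abs_ge_self]\<close>)
  have Sq: "integrable \<mu> (\<lambda>x. S x * q x)"
  proof (rule Bochner_Integration.integrable_bound)
    show "integrable \<mu> (\<lambda>x. q x + (S x)\<^sup>2 * q x)" using q_int S2q by simp
    have "\<bar>S x\<bar> \<le> 1 + (S x)\<^sup>2" for x
      using zero_le_power2[of "\<bar>S x\<bar> - 1"] by (simp add: power2_diff)
    then have "\<bar>S x\<bar> * q x \<le> (1 + (S x)\<^sup>2) * q x" for x
      using nonneg by (intro mult_right_mono) auto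
    then have "norm (S x * q x) \<le> norm (q x + (S x)\<^sup>2 * q x)" for x
      using nonneg[of x] by (simp add: abs_mult distrib_right)
    then show "AE x in \<mu>. norm (S x * q x) \<le> norm (q x + (S x)\<^sup>2 * q x)" by simp
  qed auto
  have p_int: "integrable \<mu> p"
  proof -
    have "integrable \<mu> (\<lambda>x. (p x - q x - \<gamma> * S x * q x) + (q x + \<gamma> * (S x * q x)))"
      by (intro Bochner_Integration.integrable_add d_int q_int integrable_mult_right Sq)
    then show ?thesis by simp
  qed
  have g_times: "integrable \<mu> (\<lambda>x. g x * f x)" if "integrable \<mu> f" for f :: "'a \<Rightarrow> real"
  proof (rule Bochner_Integration.integrable_bound[OF integrable_mult_right[OF that, of C]])
    have [measurable]: "f \<in> borel_measurable \<mu>" using that by simp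
    show "(\<lambda>x. g x * f x) \<in> borel_measurable \<mu>" by measurable
    show "AE x in \<mu>. norm (g x * f x) \<le> norm (C * f x)"
      using bnd C0 by (auto simp: abs_mult intro!: always_eventually mult_right_mono)
  qed
  have diff: "(LINT x|density \<mu> p. g x) - (LINT x|density \<mu> q. g x) - \<gamma> * (LINT x|density \<mu> q. g x * S x)
      = (LINT x|\<mu>. g x * (p x - q x - \<gamma> * S x * q x))"
  proof -
    have "(LINT x|density \<mu> p. g x) - (LINT x|density \<mu> q. g x) - \<gamma> * (LINT x|density \<mu> q. g x * S x)
      = (LINT x|\<mu>. g x * p x) - (LINT x|\<mu>. g x * q x) - \<gamma> * (LINT x|\<mu>. g x * (S x * q x))"
      by (subst (1 2 3) integral_density) (auto simp: nonneg mult_ac)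
    also have "\<dots> = (LINT x|\<mu>. g x * p x - g x * q x - \<gamma> * (g x * (S x * q x)))"
      using g_times[OF p_int] g_times[OF q_int] g_times[OF Sq] by simp
    also have "\<dots> = (LINT x|\<mu>. g x * (p x - q x - \<gamma> * S x * q x))"
      by (intro Bochner_Integration.integral_cong) (auto simp: algebra_simps)
    finally show ?thesis .
  qed
  have "\<bar>LINT x|\<mu>. g x * (p x - q x - \<gamma> * S x * q x)\<bar> \<le> (LINT x|\<mu>. C * ?h x)"
  proof (rule order_trans[OF integral_abs_bound], rule integral_mono)
    show "\<bar>g x * (p x - q x - \<gamma> * S x * q x)\<bar> \<le> C * ?h x" for x
      unfolding abs_mult by (intro mult_mono bnd key C0 abs_ge_zero)
  qed (intro integrable_abs integrable_mult_right g_times d_int h_int)+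
  also have "\<dots> = C * \<bar>\<gamma>\<bar> * (\<eta> + (LINT x|\<mu>. (r \<gamma> x)\<^sup>2) / \<eta>
      + 2 * \<bar>\<gamma>\<bar> * ((LINT x|\<mu>. (r \<gamma> x)\<^sup>2) + (LINT x|density \<mu> q. (S x)\<^sup>2) / 4))"
  proof -
    have g2: "\<gamma>\<^sup>2 = \<bar>\<gamma>\<bar> * \<bar>\<gamma>\<bar>" by (simp add: power2_eq_square)
    have "(LINT x|\<mu>. ?h x) = \<bar>\<gamma>\<bar> * (\<eta> * (LINT x|\<mu>. q x) + (LINT x|\<mu>. (r \<gamma> x)\<^sup>2) / \<eta>)
        + 2 * \<gamma>\<^sup>2 * ((LINT x|\<mu>. (r \<gamma> x)\<^sup>2) + (LINT x|\<mu>. (S x)\<^sup>2 * q x) / 4)"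
      using r2 q_int S2q by simp
    also have "\<dots> = \<bar>\<gamma>\<bar> * (\<eta> + (LINT x|\<mu>. (r \<gamma> x)\<^sup>2) / \<eta>
      + 2 * \<bar>\<gamma>\<bar> * ((LINT x|\<mu>. (r \<gamma> x)\<^sup>2) + (LINT x|density \<mu> q. (S x)\<^sup>2) / 4))"
      by (simp add: q_one S2q_eq distrib_left g2 mult.left_commute mult.assoc del: abs_mult_self_eq)
    finally show ?thesis by (simp only: integral_mult_right_zero mult.assoc)
  qed
  also have "\<dots> \<le> C * \<bar>\<gamma>\<bar> * (\<eta> + \<rho> / \<eta> + 2 * \<bar>\<gamma>\<bar> * (\<rho> + (LINT x|density \<mu> q. (S x)\<^sup>2) / 4))"
    using r2_le pos C0 by (intro mult_left_mono add_mono divide_right_mono) auto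
  finally show ?thesis unfolding diff .
qed

text \<open>The range of admissible \<open>\<gamma>\<close> is chosen before \<open>g\<close>. This
  uniformity is essential: the test functions used later are built from the coefficients at
  \<open>\<gamma>\<close> and so change along the path.\<close>

lemma qmd_expansion:
  fixes P :: "real \<Rightarrow> 'a measure"
  assumes qmd: "qmd_with_score P S" and ps: "prob_space (P 0)" and "0 < \<epsilon>"
  shows "\<forall>\<^sub>F \<gamma> in at 0. \<forall>g C. g \<in> borel_measurable (P 0) \<longrightarrow> (\<forall>x. \<bar>g x\<bar> \<le> C) \<longrightarrow>
     \<bar>(LINT x|P \<gamma>. g x) - (LINT x|P 0. g x) - \<gamma> * (LINT x|P 0. g x * S x)\<bar> \<le> C * \<epsilon> * \<bar>\<gamma>\<bar>"
proof -
  obtain \<mu> p q where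
    ev: "\<forall>\<^sub>F \<gamma> in at 0. sigma_finite_measure (\<mu> \<gamma>) \<and> p \<gamma> \<in> borel_measurable (\<mu> \<gamma>) \<and> (\<forall>x. 0 \<le> p \<gamma> x) \<and>
           q \<gamma> \<in> borel_measurable (\<mu> \<gamma>) \<and> (\<forall>x. 0 \<le> q \<gamma> x) \<and>
           P \<gamma> = density (\<mu> \<gamma>) (\<lambda>x. ennreal (p \<gamma> x)) \<and>
           P 0 = density (\<mu> \<gamma>) (\<lambda>x. ennreal (q \<gamma> x))"
    and lim: "((\<lambda>\<gamma>. \<integral>\<^sup>+x. ennreal
             (((sqrt (p \<gamma> x) - sqrt (q \<gamma> x)) / \<gamma> - 1 / 2 * S x * sqrt (q \<gamma> x))\<^sup>2) \<partial>\<mu> \<gamma>)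
           \<longlongrightarrow> 0) (at 0)"
    using qmd unfolding qmd_with_score_def by blast
  have S: "S \<in> borel_measurable (P 0)" "integrable (P 0) (\<lambda>x. (S x)\<^sup>2)"
    using qmd by (auto simp: qmd_with_score_def square_integrable_def)
  define \<sigma> where "\<sigma> = (LINT x|P 0. (S x)\<^sup>2)"
  have \<sigma>: "0 \<le> \<sigma>" by (simp add: \<sigma>_def)
  \<comment> \<open>With \<open>\<rho> = \<eta>\<^sup>2\<close> the first two error terms are both
    \<open>\<eta>\<close> and add up to \<open>\<epsilon> / 2\<close>; the other half of the
    tolerance is left to the term quadratic in \<open>\<gamma>\<close>.\<close>
  define \<eta> where "\<eta> = \<epsilon> / 4"
  define \<rho> where "\<rho> = \<eta>\<^sup>2"
  have pos: "0 < \<eta>" "0 < \<rho>" using \<open>0 < \<epsilon>\<close> by (auto simp: \<eta>_def \<rho>_def)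
  have small: "\<forall>\<^sub>F \<gamma> in at 0. \<bar>\<gamma>\<bar> < \<epsilon> / (4 * (\<rho> + \<sigma> / 4))"
    using \<open>0 < \<epsilon>\<close> pos \<sigma>
    by (intro order_tendstoD(2)[where y = 0]) (auto intro!: tendsto_eq_intros divide_pos_pos add_pos_nonneg)
  have "\<forall>\<^sub>F \<gamma> in at 0. (\<integral>\<^sup>+x. ennreal
             (((sqrt (p \<gamma> x) - sqrt (q \<gamma> x)) / \<gamma> - 1 / 2 * S x * sqrt (q \<gamma> x))\<^sup>2) \<partial>\<mu> \<gamma>) < ennreal \<rho>"
    using lim pos by (intro order_tendstoD(2)) auto
  moreover have "\<forall>\<^sub>F \<gamma> in at (0::real). \<gamma> \<noteq> 0" by (simp add: eventually_at_filter)
  ultimately show ?thesis using ev small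
  proof eventually_elim
    case (elim \<gamma>)
    have P: "P \<gamma> = density (\<mu> \<gamma>) (p \<gamma>)" and Q: "P 0 = density (\<mu> \<gamma>) (q \<gamma>)"
      using elim by auto
    have bm: "borel_measurable (P 0) = borel_measurable (\<mu> \<gamma>)"
      by (rule measurable_cong_sets) (simp_all add: Q)
    have small: "2 * \<bar>\<gamma>\<bar> * (\<rho> + \<sigma> / 4) \<le> \<epsilon> / 2"
      using elim(4) pos \<sigma> by (simp add: pos_less_divide_eq add_pos_nonneg algebra_simps)
    have tot: "\<eta> + \<rho> / \<eta> + 2 * \<bar>\<gamma>\<bar> * (\<rho> + \<sigma> / 4) \<le> \<epsilon>"
      using small pos by (simp add: \<rho>_def power2_eq_square) (simp add: \<eta>_def)
    show ?case
    proof (intro allI impI)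
      fix g :: "'a \<Rightarrow> real" and C
      assume g: "g \<in> borel_measurable (P 0)" "\<forall>x. \<bar>g x\<bar> \<le> C"
      then have C0: "0 \<le> C" using abs_ge_zero order_trans by blast
      have "\<bar>(LINT x|density (\<mu> \<gamma>) (p \<gamma>). g x) - (LINT x|density (\<mu> \<gamma>) (q \<gamma>). g x)
           - \<gamma> * (LINT x|density (\<mu> \<gamma>) (q \<gamma>). g x * S x)\<bar>
         \<le> C * \<bar>\<gamma>\<bar> * (\<eta> + \<rho> / \<eta> + 2 * \<bar>\<gamma>\<bar> * (\<rho> + (LINT x|density (\<mu> \<gamma>) (q \<gamma>). (S x)\<^sup>2) / 4))"
        by (rule qmd_remainder_bound)
           (use elim S ps g pos in \<open>auto simp: bm[symmetric] P[symmetric] Q[symmetric]\<close>)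
      also have "\<dots> \<le> C * \<bar>\<gamma>\<bar> * \<epsilon>"
        using tot C0 by (intro mult_left_mono) (auto simp: Q[symmetric] \<sigma>_def)
      finally show "\<bar>(LINT x|P \<gamma>. g x) - (LINT x|P 0. g x) - \<gamma> * (LINT x|P 0. g x * S x)\<bar> \<le> C * \<epsilon> * \<bar>\<gamma>\<bar>"
        by (simp add: P[symmetric] Q[symmetric] mult_ac)
    qed
  qed
qed

section \<open>Covariances of truncated linear forms\<close>

text \<open>A truncated identity: bounded by \<open>1 / \<tau>\<close>, 1-Lipschitz, and close to
  \<open>w\<close> for small \<open>\<tau>\<close>. Smoothness matters as well, because a shift of
  the argument by \<open>\<zeta>\<close> must change the value by \<open>- \<zeta>\<close> up to an
  error with a factor \<open>\<tau>\<close>.\<close>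

definition rsin :: "real \<Rightarrow> real \<Rightarrow> real" where
  "rsin \<tau> w = sin (\<tau> * w) / \<tau>"

lemma rsin_measurable [measurable]: "rsin \<tau> \<in> borel_measurable borel"
  unfolding rsin_def by measurable

lemma sin_diff_le: "\<bar>sin x - sin y\<bar> \<le> \<bar>x - y\<bar>" for x y :: real
proof -
  have "\<bar>sin x - sin y\<bar> = 2 * \<bar>sin ((x - y) / 2)\<bar> * \<bar>cos ((x + y) / 2)\<bar>"
    by (simp add: sin_diff_sin abs_mult)
  also have "\<dots> \<le> 2 * \<bar>(x - y) / 2\<bar> * 1"
    by (intro mult_mono abs_sin_x_le_abs_x mult_left_mono) auto
  finally show ?thesis by simp
qed

text \<open>Mean value bound for \<open>sin w - w\<close>, whose derivative satisfies
  \<open>\<bar>cos w - 1\<bar> \<le> \<bar>w\<bar>\<close>. This linear bound already yields a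
  factor \<open>\<tau>\<close> after rescaling, and it keeps later products at third
  moments.\<close>

lemma sin_shift_le: "\<bar>sin (u - x) - sin u + x\<bar> \<le> \<bar>x\<bar> * (\<bar>u\<bar> + \<bar>x\<bar>)" for x u :: real
proof -
  have "\<bar>sin u - u - (sin (u - x) - (u - x))\<bar> \<le> (\<bar>u\<bar> + \<bar>x\<bar>) * norm (u - (u - x))"
    unfolding real_norm_def[symmetric]
  proof (rule field_differentiable_bound[where S = "{- (\<bar>u\<bar> + \<bar>x\<bar>) .. \<bar>u\<bar> + \<bar>x\<bar>}" and f' = "\<lambda>w. cos w - 1"])
    fix w assume w: "w \<in> {- (\<bar>u\<bar> + \<bar>x\<bar>) .. \<bar>u\<bar> + \<bar>x\<bar>}"
    have "\<bar>cos w - 1\<bar> = 2 * (\<bar>sin (w / 2)\<bar> * \<bar>sin (w / 2)\<bar>)"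
      using cos_double_sin[of "w / 2"] by (simp add: power2_eq_square)
    also have "\<dots> \<le> 2 * (\<bar>w / 2\<bar> * 1)"
      by (intro mult_mono abs_sin_x_le_abs_x) auto
    finally show "norm (cos w - 1) \<le> norm u + norm x" using w by auto
  qed (auto intro!: derivative_eq_intros)
  then show ?thesis by (simp add: algebra_simps abs_minus_commute)
qed

context
  fixes \<tau> :: real assumes \<tau>: "0 < \<tau>"
begin

lemma rsin_diff_le: "\<bar>rsin \<tau> (w - \<zeta>) - rsin \<tau> w\<bar> \<le> \<bar>\<zeta>\<bar>"
  using sin_diff_le[of "\<tau> * (w - \<zeta>)" "\<tau> * w"] \<tau>
  by (simp add: rsin_def flip: diff_divide_distrib) (simp add: pos_divide_le_eq right_diff_distrib abs_mult mult.commute)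

lemma rsin_le: "\<bar>rsin \<tau> w\<bar> \<le> \<bar>w\<bar>"
  using rsin_diff_le[of 0 "- w"] by (simp add: rsin_def)

lemma rsin_bounded: "\<bar>rsin \<tau> w\<bar> \<le> 1 / \<tau>"
  using \<tau> by (simp add: rsin_def divide_right_mono)

lemma rsin_shift_le: "\<bar>rsin \<tau> (w - \<zeta>) - rsin \<tau> w + \<zeta>\<bar> \<le> \<tau> * (\<bar>\<zeta>\<bar> * (\<bar>w\<bar> + \<bar>\<zeta>\<bar>))"
proof -
  have "\<bar>rsin \<tau> (w - \<zeta>) - rsin \<tau> w + \<zeta>\<bar> = \<bar>sin (\<tau> * w - \<tau> * \<zeta>) - sin (\<tau> * w) + \<tau> * \<zeta>\<bar> / \<tau>"
    using \<tau> by (simp add: rsin_def field_simps)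
  also have "\<dots> \<le> \<bar>\<tau> * \<zeta>\<bar> * (\<bar>\<tau> * w\<bar> + \<bar>\<tau> * \<zeta>\<bar>) / \<tau>"
    using \<tau> by (intro divide_right_mono sin_shift_le) auto
  also have "\<dots> = \<tau> * (\<bar>\<zeta>\<bar> * (\<bar>w\<bar> + \<bar>\<zeta>\<bar>))"
    using \<tau> by (simp add: abs_mult field_simps)
  finally show ?thesis .
qed

lemma rsin_approx: "\<bar>rsin \<tau> w - w\<bar> \<le> \<tau> * w\<^sup>2"
  using rsin_shift_le[of 0 "- w"] by (simp add: rsin_def power2_eq_square)

text \<open>The quadratic bound is good for small \<open>m\<close>, the linear one for large
  \<open>m\<close>. Against the score a third power of \<open>norm x\<close> need not be integrable,
  so both are merged into a bound of linear growth that still tends to 0 with \<open>\<tau>\<close>.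
  Since \<open>1 \<le> K\<close>, one constant \<open>2 * K\<^sup>2\<close> serves both.\<close>

lemma rsin_approx_min:
  assumes "\<bar>w\<bar> \<le> K * m" "1 \<le> K" "0 \<le> m"
  shows "\<bar>rsin \<tau> w - w\<bar> \<le> 2 * K\<^sup>2 * (m * min (\<tau> * m) 1)"
proof -
  have K2: "K \<le> K\<^sup>2" using assms by (simp add: power2_eq_square)
  have "\<tau> * w\<^sup>2 \<le> \<tau> * (K * m)\<^sup>2"
    using assms \<tau> by (intro mult_left_mono power2_le_iff_abs_le[THEN iffD2]) auto
  also have "\<dots> = K\<^sup>2 * (m * (\<tau> * m))" by (simp add: power2_eq_square)
  also have "\<dots> \<le> 2 * K\<^sup>2 * (m * (\<tau> * m))" using \<tau> assms by simp
  finally have 1: "\<bar>rsin \<tau> w - w\<bar> \<le> 2 * K\<^sup>2 * (m * (\<tau> * m))" using rsin_approx[of w] by simp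
  have "\<bar>rsin \<tau> w - w\<bar> \<le> 2 * (K * m)" using rsin_le[of w] assms(1) by linarith
  also have "\<dots> \<le> 2 * (K\<^sup>2 * m)" using K2 assms by (intro mult_left_mono mult_right_mono) auto
  finally show ?thesis using 1 by (simp add: min_def)
qed

end

section \<open>Moment bounds and first-order expansions under a fixed law\<close>

locale fourth_moment = prob_space Q for Q :: "'a::euclidean_space measure" +
  fixes S :: "'a \<Rightarrow> real"
  assumes sets_Q [measurable_cong]: "sets Q = sets borel"
    and mom4: "integrable Q (\<lambda>x. norm x ^ 4)"
    and mean0: "\<And>w. (LINT x|Q. w \<bullet> x) = 0"
    and S_meas [measurable]: "S \<in> borel_measurable Q"
    and S2: "integrable Q (\<lambda>x. (S x)\<^sup>2)"
begin

lemma integrable_power: "k \<le> 4 \<Longrightarrow> integrable Q (\<lambda>x. norm x ^ k)"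
proof (rule Bochner_Integration.integrable_bound[where f = "\<lambda>x. 1 + norm x ^ 4"])
  assume k: "k \<le> 4"
  have "norm x ^ k \<le> 1 + norm x ^ 4" for x :: 'a
  proof (cases "norm x \<le> 1")
    case True
    then show ?thesis using power_le_one[of "norm x" k] by (simp add: add_increasing2)
  next
    case False
    then show ?thesis using power_increasing[OF k, of "norm x"] by linarith
  qed
  then show "AE x in Q. norm (norm x ^ k) \<le> norm (1 + norm x ^ 4)" by simp
qed (use mom4 in auto)

definition mo :: "nat \<Rightarrow> real" where "mo k = (LINT x|Q. norm x ^ k)"
definition moS :: "nat \<Rightarrow> real" where "moS k = (LINT x|Q. norm x ^ k * \<bar>S x\<bar>)"

lemma mo_nonneg: "0 \<le> mo k" by (simp add: mo_def)
lemma moS_nonneg: "0 \<le> moS k" by (simp add: moS_def)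

lemma integrable_dom:
  assumes "f \<in> borel_measurable borel" "\<And>x. \<bar>f x\<bar> \<le> C * norm x ^ k" "k \<le> 4"
  shows "integrable Q f"
proof (rule Bochner_Integration.integrable_bound[OF integrable_mult_right[OF integrable_power[OF assms(3)], of C]])
  show "f \<in> borel_measurable Q" using assms(1) by measurable
  show "AE x in Q. norm (f x) \<le> norm (C * norm x ^ k)"
    using assms(2) by (auto intro!: always_eventually order_trans[OF _ abs_ge_self])
qed

lemma integral_dom:
  assumes "f \<in> borel_measurable borel" "\<And>x. \<bar>f x\<bar> \<le> C * norm x ^ k" "k \<le> 4"
  shows "\<bar>LINT x|Q. f x\<bar> \<le> C * mo k"
proof -
  have "\<bar>LINT x|Q. f x\<bar> \<le> (LINT x|Q. \<bar>f x\<bar>)" by (rule integral_abs_bound)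
  also have "\<dots> \<le> (LINT x|Q. C * norm x ^ k)"
    using integrable_dom[OF assms] integrable_power[OF assms(3)] assms(2) by (intro integral_mono) auto
  finally show ?thesis by (simp add: mo_def)
qed

text \<open>The product is split into \<open>norm x ^ (2 * k)\<close> and
  \<open>(S x)\<^sup>2\<close>, so fourth moments allow \<open>k\<close> up to 2.\<close>

lemma integrable_power_score: "k \<le> 2 \<Longrightarrow> integrable Q (\<lambda>x. norm x ^ k * \<bar>S x\<bar>)"
proof (rule Bochner_Integration.integrable_bound[where f = "\<lambda>x. norm x ^ (k * 2) + (S x)\<^sup>2"])
  have "a * \<bar>b\<bar> \<le> a\<^sup>2 + b\<^sup>2" if "0 \<le> a" for a b :: real
    using zero_le_power2[of "a - \<bar>b\<bar>"] mult_nonneg_nonneg[OF that abs_ge_zero, of b]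
    unfolding power2_diff power2_abs by linarith
  then show "AE x in Q. norm (norm x ^ k * \<bar>S x\<bar>) \<le> norm (norm x ^ (k * 2) + (S x)\<^sup>2)"
    by (auto simp: abs_mult power_mult intro!: always_eventually order_trans[OF _ abs_ge_self])
qed (use integrable_power[of "k * 2"] S2 in auto)

lemma integrable_dom_score:
  assumes "f \<in> borel_measurable borel" "\<And>x. \<bar>f x\<bar> \<le> C * norm x ^ k" "k \<le> 2"
  shows "integrable Q (\<lambda>x. f x * S x)"
proof (rule Bochner_Integration.integrable_bound[OF integrable_mult_right[OF integrable_power_score[OF assms(3)], of C]])
  show "(\<lambda>x. f x * S x) \<in> borel_measurable Q" using assms(1) by measurable
  have "norm (f x * S x) \<le> norm (C * (norm x ^ k * \<bar>S x\<bar>))" for x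
    using mult_right_mono[OF assms(2)[of x] abs_ge_zero, of "S x"]
    by (simp add: abs_mult[of "f x"] mult.assoc)
  then show "AE x in Q. norm (f x * S x) \<le> norm (C * (norm x ^ k * \<bar>S x\<bar>))" by simp
qed

lemma integral_dom_score:
  assumes "f \<in> borel_measurable borel" "\<And>x. \<bar>f x\<bar> \<le> C * norm x ^ k" "k \<le> 2"
  shows "\<bar>LINT x|Q. f x * S x\<bar> \<le> C * moS k"
proof -
  have "\<bar>LINT x|Q. f x * S x\<bar> \<le> (LINT x|Q. \<bar>f x * S x\<bar>)" by (rule integral_abs_bound)
  also have "\<dots> \<le> (LINT x|Q. C * (norm x ^ k * \<bar>S x\<bar>))"
  proof (rule integral_mono)
    show "\<bar>f x * S x\<bar> \<le> C * (norm x ^ k * \<bar>S x\<bar>)" for x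
      using mult_right_mono[OF assms(2)[of x] abs_ge_zero, of "S x"] by (simp add: abs_mult mult.assoc)
  qed (use integrable_dom_score[OF assms] integrable_power_score[OF assms(3)] in
      \<open>auto intro: integrable_abs\<close>)
  finally show ?thesis by (simp add: moS_def)
qed

lemma inner_le: "norm w \<le> K \<Longrightarrow> \<bar>w \<bullet> x\<bar> \<le> K * norm x"
  by (meson Cauchy_Schwarz_ineq2 mult_right_mono norm_ge_zero order_trans)

lemma prod_le2:
  fixes x :: 'a
  assumes "\<bar>a\<bar> \<le> A * norm x ^ i" "\<bar>b\<bar> \<le> B * norm x ^ j" "k = i + j"
  shows "\<bar>a * b\<bar> \<le> A * B * norm x ^ k"
proof -
  have "\<bar>a * b\<bar> \<le> (A * norm x ^ i) * (B * norm x ^ j)"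
    unfolding abs_mult using assms by (intro mult_mono) (auto intro: order_trans[OF abs_ge_zero])
  then show ?thesis by (simp add: assms(3) power_add mult_ac)
qed

text \<open>The error is linear in \<open>norm e\<close> however large the perturbation \<open>e\<close>, so that it can be used before
  the increment of the coefficients is known to be small.\<close>

lemma cov_perturb:
  fixes u e w :: 'a
  defines "q \<equiv> \<lambda>\<tau> x. rsin \<tau> (u \<bullet> x - e \<bullet> x) - rsin \<tau> (u \<bullet> x)" and "p \<equiv> \<lambda>\<tau> x. rsin \<tau> (w \<bullet> x)"
  assumes \<tau>: "0 < \<tau>" and K: "norm u \<le> K" "norm e \<le> K" "norm w \<le> K"
  shows "\<bar>(LINT x|Q. q \<tau> x * p \<tau> x) - (LINT x|Q. q \<tau> x) * (LINT x|Q. p \<tau> x)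
           + (LINT x|Q. (e \<bullet> x) * (w \<bullet> x))\<bar> \<le> K\<^sup>2 * (3 * mo 3 + mo 1 * mo 2) * (\<tau> * norm e)"
proof -
  have K0: "0 \<le> K" using K(1) norm_ge_zero order_trans by blast
  have [measurable]: "q \<tau> \<in> borel_measurable borel" "p \<tau> \<in> borel_measurable borel"
    unfolding q_def p_def by measurable
  have p1: "\<bar>p \<tau> x\<bar> \<le> K * norm x ^ 1" for x
    unfolding p_def using rsin_le[OF \<tau>] inner_le[OF K(3)] by (metis order_trans power_one_right)
  have q1: "\<bar>q \<tau> x\<bar> \<le> norm e * norm x ^ 1" for x
    unfolding q_def using rsin_diff_le[OF \<tau>] inner_le[OF order_refl, of e] by (metis order_trans power_one_right)
  have p2: "\<bar>p \<tau> x - w \<bullet> x\<bar> \<le> \<tau> * K\<^sup>2 * norm x ^ 2" for x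
  proof -
    have "(w \<bullet> x)\<^sup>2 \<le> (K * norm x)\<^sup>2" by (intro abs_le_square_iff[THEN iffD1] order_trans[OF inner_le[OF K(3)]]) simp
    then show ?thesis unfolding p_def
      by (intro order_trans[OF rsin_approx[OF \<tau>]]) (use \<tau> in \<open>simp add: power_mult_distrib mult.assoc\<close>)
  qed
  have q2: "\<bar>q \<tau> x + e \<bullet> x\<bar> \<le> \<tau> * norm e * (2 * K) * norm x ^ 2" for x
  proof -
    have "\<bar>q \<tau> x + e \<bullet> x\<bar> \<le> \<tau> * (\<bar>e \<bullet> x\<bar> * (\<bar>u \<bullet> x\<bar> + \<bar>e \<bullet> x\<bar>))"
      unfolding q_def by (rule rsin_shift_le[OF \<tau>])
    also have "\<dots> \<le> \<tau> * ((norm e * norm x) * (K * norm x + K * norm x))"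
      using \<tau> by (intro mult_left_mono mult_mono add_mono inner_le K order_refl) auto
    finally show ?thesis by (simp add: power2_eq_square mult_ac)
  qed
  have e1: "\<bar>e \<bullet> x\<bar> \<le> norm e * norm x ^ 1" and w1: "\<bar>w \<bullet> x\<bar> \<le> K * norm x ^ 1" for x
    using inner_le[OF order_refl, of e x] inner_le[OF K(3), of x] by auto
  have Iqp: "integrable Q (\<lambda>x. q \<tau> x * p \<tau> x)"
    by (rule integrable_dom[OF _ prod_le2[OF q1 p1 refl]]) auto
  have Iew: "integrable Q (\<lambda>x. (e \<bullet> x) * (w \<bullet> x))"
    by (rule integrable_dom[OF _ prod_le2[OF e1 w1 refl]]) auto
  have I1: "integrable Q (\<lambda>x. (q \<tau> x + e \<bullet> x) * p \<tau> x)"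
    by (rule integrable_dom[OF _ prod_le2[OF q2 p1 refl]]) auto
  have I2: "integrable Q (\<lambda>x. (e \<bullet> x) * (p \<tau> x - w \<bullet> x))"
    by (rule integrable_dom[OF _ prod_le2[OF e1 p2 refl]]) auto
  \<comment> \<open>Replacing first \<open>q\<close> and then \<open>p\<close> by its linear part
    leaves two remainders that each carry both factors, \<open>\<tau>\<close> and
    \<open>norm e\<close>.\<close>
  have "(LINT x|Q. q \<tau> x * p \<tau> x) + (LINT x|Q. (e \<bullet> x) * (w \<bullet> x))
     = (LINT x|Q. q \<tau> x * p \<tau> x + (e \<bullet> x) * (w \<bullet> x))" using Iqp Iew by simp
  also have "\<dots> = (LINT x|Q. (q \<tau> x + e \<bullet> x) * p \<tau> x - (e \<bullet> x) * (p \<tau> x - w \<bullet> x))"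
    by (intro Bochner_Integration.integral_cong) (auto simp: algebra_simps)
  also have "\<dots> = (LINT x|Q. (q \<tau> x + e \<bullet> x) * p \<tau> x) - (LINT x|Q. (e \<bullet> x) * (p \<tau> x - w \<bullet> x))"
    using I1 I2 by simp
  finally have split: "(LINT x|Q. q \<tau> x * p \<tau> x) + (LINT x|Q. (e \<bullet> x) * (w \<bullet> x))
    = (LINT x|Q. (q \<tau> x + e \<bullet> x) * p \<tau> x) - (LINT x|Q. (e \<bullet> x) * (p \<tau> x - w \<bullet> x))" .
  have b1: "\<bar>LINT x|Q. (q \<tau> x + e \<bullet> x) * p \<tau> x\<bar> \<le> \<tau> * norm e * (2 * K) * K * mo 3"
    by (rule integral_dom[OF _ prod_le2[OF q2 p1]]) auto
  have b2: "\<bar>LINT x|Q. (e \<bullet> x) * (p \<tau> x - w \<bullet> x)\<bar> \<le> norm e * (\<tau> * K\<^sup>2) * mo 3"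
    by (rule integral_dom[OF _ prod_le2[OF e1 p2]]) auto
  have b3: "\<bar>LINT x|Q. q \<tau> x\<bar> \<le> norm e * mo 1"
    by (rule integral_dom[OF _ q1]) auto
  \<comment> \<open>The linear form has mean zero, so the mean of its truncation is of order
    \<open>\<tau>\<close>. This supplies the factor \<open>\<tau>\<close> in the product of the
    means; the mean of \<open>q\<close> supplies only \<open>norm e\<close>.\<close>
  have "integrable Q (p \<tau>)" by (rule integrable_dom[OF _ p1]) auto
  moreover have "integrable Q (\<lambda>x. w \<bullet> x)" by (rule integrable_dom[OF _ w1]) auto
  ultimately have "(LINT x|Q. p \<tau> x) = (LINT x|Q. p \<tau> x - w \<bullet> x)"
    by (simp add: mean0)
  then have b4: "\<bar>LINT x|Q. p \<tau> x\<bar> \<le> \<tau> * K\<^sup>2 * mo 2"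
    using integral_dom[OF _ p2] by auto
  have "\<bar>(LINT x|Q. q \<tau> x) * (LINT x|Q. p \<tau> x)\<bar> \<le> (norm e * mo 1) * (\<tau> * K\<^sup>2 * mo 2)"
    unfolding abs_mult using b3 b4 by (intro mult_mono) (auto intro: order_trans[OF abs_ge_zero])
  then have "\<bar>(LINT x|Q. q \<tau> x * p \<tau> x) - (LINT x|Q. q \<tau> x) * (LINT x|Q. p \<tau> x)
           + (LINT x|Q. (e \<bullet> x) * (w \<bullet> x))\<bar> \<le> \<tau> * norm e * (2 * K) * K * mo 3
     + norm e * (\<tau> * K\<^sup>2) * mo 3 + (norm e * mo 1) * (\<tau> * K\<^sup>2 * mo 2)"
    using split b1 b2 by linarith
  then show ?thesis by (simp add: algebra_simps power2_eq_square)
qed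


text \<open>The truncation error of a product of two linear forms, weighted by the score. It takes
  the place of \<open>\<tau>\<close> times a third moment against \<open>S\<close>, which may be
  infinite. Dominated convergence makes it vanish along \<open>\<tau> = 1 / (n + 1)\<close>, which
  is enough because \<open>\<tau>\<close> is only ever chosen small.\<close>

definition tail_score :: "real \<Rightarrow> real" where
  "tail_score \<tau> = (LINT x|Q. norm x ^ 2 * min (\<tau> * norm x) 1 * \<bar>S x\<bar>)"

lemma integrable_tail: "0 \<le> \<tau> \<Longrightarrow> integrable Q (\<lambda>x. norm x ^ 2 * min (\<tau> * norm x) 1 * \<bar>S x\<bar>)"
  by (rule Bochner_Integration.integrable_bound[OF integrable_power_score[of 2]])
     (auto simp: abs_mult intro!: always_eventually mult_right_mono mult_left_le)

lemma tail_score_nonneg: "0 \<le> \<tau> \<Longrightarrow> 0 \<le> tail_score \<tau>"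
  by (simp add: tail_score_def)

lemma tail_score_tendsto: "(\<lambda>n. tail_score (inverse (real (Suc n)))) \<longlonglongrightarrow> 0"
proof -
  have "(\<lambda>n. tail_score (inverse (real (Suc n)))) \<longlonglongrightarrow> (LINT x|Q. 0)"
    unfolding tail_score_def
  proof (rule integral_dominated_convergence[where w = "\<lambda>x. norm x ^ 2 * \<bar>S x\<bar>"])
    have "(\<lambda>n. norm x ^ 2 * min (inverse (real (Suc n)) * norm x) 1 * \<bar>S x\<bar>) \<longlonglongrightarrow>
          norm x ^ 2 * min (0 * norm x) 1 * \<bar>S x\<bar>" for x
      by (intro tendsto_intros LIMSEQ_inverse_real_of_nat)
    then show "AE x in Q. (\<lambda>n. norm x ^ 2 * min (inverse (real (Suc n)) * norm x) 1 * \<bar>S x\<bar>) \<longlonglongrightarrow> 0"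
      by simp
  qed (auto simp: abs_mult integrable_power_score intro!: always_eventually mult_right_mono mult_left_le
      simp del: of_nat_Suc)
  then show ?thesis by simp
qed

text \<open>The difference of products telescopes, and each factor is off by a shift
  (\<open>norm d\<close> or \<open>norm D\<close>) plus a truncation error
  \<open>2 * K\<^sup>2 * n\<close>. The constant 6 is 4 + 2: the first truncation error is
  multiplied by \<open>2 * K * norm x\<close>, the second by \<open>K * norm x\<close>.\<close>

lemma score_perturb:
  fixes z h d D :: 'a
  defines "f \<equiv> \<lambda>\<tau> x. rsin \<tau> (z \<bullet> x - d \<bullet> x)" and "g \<equiv> \<lambda>\<tau> x. rsin \<tau> (h \<bullet> x - D \<bullet> x)"
  assumes \<tau>: "0 < \<tau>" and K: "norm z \<le> K" "norm h \<le> K" "norm d \<le> K" "norm D \<le> K" "1 \<le> K"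
  shows "\<bar>(LINT x|Q. f \<tau> x * g \<tau> x * S x) - (LINT x|Q. (z \<bullet> x) * (h \<bullet> x) * S x)\<bar>
     \<le> 2 * K * (norm d + norm D) * moS 2 + 6 * K^3 * tail_score \<tau>"
proof -
  have [measurable]: "f \<tau> \<in> borel_measurable borel" "g \<tau> \<in> borel_measurable borel"
    unfolding f_def g_def by measurable
  have K0: "0 \<le> K" using K by simp
  have gK: "\<bar>g \<tau> x\<bar> \<le> 2 * K * norm x" and fK: "\<bar>f \<tau> x\<bar> \<le> 2 * K * norm x" for x
    using rsin_le[OF \<tau>, of "h \<bullet> x - D \<bullet> x"] rsin_le[OF \<tau>, of "z \<bullet> x - d \<bullet> x"] inner_le[OF K(1), of x]
      inner_le[OF K(2), of x] inner_le[OF K(3), of x] inner_le[OF K(4), of x]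
    unfolding f_def g_def by linarith+
  have key: "\<bar>f \<tau> x * g \<tau> x - (z \<bullet> x) * (h \<bullet> x)\<bar> \<le>
     2 * K * (norm d + norm D) * norm x ^ 2 + 6 * K^3 * (norm x ^ 2 * min (\<tau> * norm x) 1)" for x
  proof -
    define n where "n = norm x * min (\<tau> * norm x) 1"
    have n: "0 \<le> n" using \<tau> by (simp add: n_def)
    define f0 g0 where "f0 = rsin \<tau> (z \<bullet> x)" and "g0 = rsin \<tau> (h \<bullet> x)"
    have "\<bar>f \<tau> x - f0\<bar> \<le> norm d * norm x" "\<bar>g \<tau> x - g0\<bar> \<le> norm D * norm x"
      unfolding f_def g_def f0_def g0_def
      by (rule order_trans[OF rsin_diff_le[OF \<tau>] inner_le], simp)+
    moreover have "\<bar>f0 - z \<bullet> x\<bar> \<le> 2 * K\<^sup>2 * n" "\<bar>g0 - h \<bullet> x\<bar> \<le> 2 * K\<^sup>2 * n"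
      unfolding f0_def g0_def n_def by (rule rsin_approx_min[OF \<tau>]; use inner_le K in auto)+
    ultimately have a: "\<bar>f \<tau> x - z \<bullet> x\<bar> \<le> norm d * norm x + 2 * K\<^sup>2 * n"
        "\<bar>g \<tau> x - h \<bullet> x\<bar> \<le> norm D * norm x + 2 * K\<^sup>2 * n" by linarith+
    have zx: "\<bar>z \<bullet> x\<bar> \<le> K * norm x" using inner_le K by auto
    have eq: "f \<tau> x * g \<tau> x - (z \<bullet> x) * (h \<bullet> x) = (f \<tau> x - z \<bullet> x) * g \<tau> x + (z \<bullet> x) * (g \<tau> x - h \<bullet> x)"
      by (simp add: algebra_simps)
    have "\<bar>f \<tau> x * g \<tau> x - (z \<bullet> x) * (h \<bullet> x)\<bar> \<le> (norm d * norm x + 2 * K\<^sup>2 * n) * (2 * K * norm x) + (K * norm x) * (norm D * norm x + 2 * K\<^sup>2 * n)"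
      unfolding eq by (intro order_trans[OF abs_triangle_ineq] add_mono, unfold abs_mult; intro mult_mono a gK zx)
         (use n K0 in auto)
    also have "\<dots> = K * (2 * norm d + norm D) * (norm x)\<^sup>2 + 6 * K^3 * (norm x * n)"
      by (simp add: power2_eq_square power3_eq_cube algebra_simps)
    also have "\<dots> \<le> K * (2 * (norm d + norm D)) * (norm x)\<^sup>2 + 6 * K^3 * (norm x * n)"
      using K0 by (intro add_mono mult_right_mono mult_left_mono) auto
    finally show ?thesis by (simp add: n_def power2_eq_square mult_ac)
  qed
  have If: "integrable Q (\<lambda>x. f \<tau> x * g \<tau> x * S x)"
  proof (rule integrable_dom_score)
    show "\<bar>f \<tau> x * g \<tau> x\<bar> \<le> (2 * K) * (2 * K) * norm x ^ 2" for x
      using fK[of x] gK[of x] by (intro prod_le2[where i = 1 and j = 1]) auto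
  qed auto
  have Iz: "integrable Q (\<lambda>x. (z \<bullet> x) * (h \<bullet> x) * S x)"
  proof (rule integrable_dom_score)
    show "\<bar>(z \<bullet> x) * (h \<bullet> x)\<bar> \<le> K * K * norm x ^ 2" for x
      using inner_le[of z K x] inner_le[of h K x] K by (intro prod_le2[where i = 1 and j = 1]) auto
  qed auto
  have eq: "(LINT x|Q. f \<tau> x * g \<tau> x * S x) - (LINT x|Q. (z \<bullet> x) * (h \<bullet> x) * S x)
      = (LINT x|Q. (f \<tau> x * g \<tau> x - (z \<bullet> x) * (h \<bullet> x)) * S x)"
    using If Iz by (simp add: left_diff_distrib)
  have "\<bar>LINT x|Q. (f \<tau> x * g \<tau> x - (z \<bullet> x) * (h \<bullet> x)) * S x\<bar> \<le> (LINT x|Q. \<bar>(f \<tau> x * g \<tau> x - (z \<bullet> x) * (h \<bullet> x)) * S x\<bar>)" by (rule integral_abs_bound)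
  also have "\<dots> \<le> (LINT x|Q. 2 * K * (norm d + norm D) * (norm x ^ 2 * \<bar>S x\<bar>)
       + 6 * K^3 * (norm x ^ 2 * min (\<tau> * norm x) 1 * \<bar>S x\<bar>))"
  proof (rule integral_mono)
    show "\<bar>(f \<tau> x * g \<tau> x - z \<bullet> x * (h \<bullet> x)) * S x\<bar> \<le> 2 * K * (norm d + norm D) * (norm x ^ 2 * \<bar>S x\<bar>)
       + 6 * K^3 * (norm x ^ 2 * min (\<tau> * norm x) 1 * \<bar>S x\<bar>)" for x
      using mult_right_mono[OF key[of x] abs_ge_zero[of "S x"]]
      by (simp add: abs_mult distrib_right mult.assoc)
    have "integrable Q (\<lambda>x. f \<tau> x * g \<tau> x * S x - (z \<bullet> x) * (h \<bullet> x) * S x)" using If Iz by simp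
    then show "integrable Q (\<lambda>x. \<bar>(f \<tau> x * g \<tau> x - z \<bullet> x * (h \<bullet> x)) * S x\<bar>)"
      by (intro integrable_abs) (simp add: left_diff_distrib)
    show "integrable Q (\<lambda>x. 2 * K * (norm d + norm D) * (norm x ^ 2 * \<bar>S x\<bar>)
       + 6 * K^3 * (norm x ^ 2 * min (\<tau> * norm x) 1 * \<bar>S x\<bar>))"
      using \<tau> by (intro Bochner_Integration.integrable_add integrable_mult_right integrable_tail integrable_power_score) auto
  qed
  also have "\<dots> = 2 * K * (norm d + norm D) * moS 2 + 6 * K^3 * tail_score \<tau>"
    unfolding moS_def tail_score_def using \<tau> integrable_tail[of \<tau>] integrable_power_score[of 2] by simp
  finally show ?thesis unfolding eq .
qed

text \<open>Covariance is bilinear. With \<open>f = f0 + f1\<close> and \<open>g = g0 + g1\<close>,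
  where the index 1 marks the effect of the shift, the unshifted pair contributes nothing by
  \<open>uncorr\<close>, each mixed pair is linearised by \<open>cov_perturb\<close>, and the pair
  of shifts is of second order, \<open>norm d * norm D\<close>.\<close>

lemma cov_expansion:
  fixes z h d D :: 'a
  defines "f \<equiv> \<lambda>\<tau> x. rsin \<tau> (z \<bullet> x - d \<bullet> x)" and "g \<equiv> \<lambda>\<tau> x. rsin \<tau> (h \<bullet> x - D \<bullet> x)"
  assumes \<tau>: "0 < \<tau>" and K: "norm z \<le> K" "norm h \<le> K" "norm d \<le> K" "norm D \<le> K" "1 \<le> K"
    and uncorr: "(LINT x|Q. rsin \<tau> (z \<bullet> x) * rsin \<tau> (h \<bullet> x))
        = (LINT x|Q. rsin \<tau> (z \<bullet> x)) * (LINT x|Q. rsin \<tau> (h \<bullet> x))"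
  shows "\<bar>(LINT x|Q. f \<tau> x * g \<tau> x) - (LINT x|Q. f \<tau> x) * (LINT x|Q. g \<tau> x)
      + (LINT x|Q. (d \<bullet> x) * (h \<bullet> x)) + (LINT x|Q. (z \<bullet> x) * (D \<bullet> x))\<bar>
    \<le> K\<^sup>2 * (3 * mo 3 + mo 1 * mo 2) * (\<tau> * (norm d + norm D)) + (mo 2 + (mo 1)\<^sup>2) * (norm d * norm D)"
    (is "\<bar>?L\<bar> \<le> ?R")
proof -
  define f0 where "f0 = (\<lambda>x. rsin \<tau> (z \<bullet> x))"
  define g0 where "g0 = (\<lambda>x. rsin \<tau> (h \<bullet> x))"
  define f1 where "f1 = (\<lambda>x. rsin \<tau> (z \<bullet> x - d \<bullet> x) - rsin \<tau> (z \<bullet> x))"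
  define g1 where "g1 = (\<lambda>x. rsin \<tau> (h \<bullet> x - D \<bullet> x) - rsin \<tau> (h \<bullet> x))"
  have [measurable]: "f0 \<in> borel_measurable borel" "g0 \<in> borel_measurable borel"
     "f1 \<in> borel_measurable borel" "g1 \<in> borel_measurable borel"
    unfolding f0_def g0_def f1_def g1_def by measurable
  have f: "f \<tau> = (\<lambda>x. f0 x + f1 x)" and g: "g \<tau> = (\<lambda>x. g0 x + g1 x)"
    by (auto simp: f_def g_def f0_def f1_def g0_def g1_def)
  have b: "\<bar>f0 x\<bar> \<le> K * norm x ^ 1" "\<bar>g0 x\<bar> \<le> K * norm x ^ 1"
      "\<bar>f1 x\<bar> \<le> norm d * norm x ^ 1" "\<bar>g1 x\<bar> \<le> norm D * norm x ^ 1" for x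
    unfolding f0_def g0_def f1_def g1_def power_one_right
    by (auto intro!: order_trans[OF rsin_le[OF \<tau>] inner_le] order_trans[OF rsin_diff_le[OF \<tau>] inner_le] K)
  have I1: "integrable Q f0" "integrable Q g0" "integrable Q f1" "integrable Q g1"
    by (rule integrable_dom[OF _ b(1)] integrable_dom[OF _ b(2)] integrable_dom[OF _ b(3)]
        integrable_dom[OF _ b(4)]; simp)+
  have I2: "integrable Q (\<lambda>x. f0 x * g0 x)" "integrable Q (\<lambda>x. f1 x * g0 x)"
      "integrable Q (\<lambda>x. g1 x * f0 x)" "integrable Q (\<lambda>x. f1 x * g1 x)"
    by (rule integrable_dom[OF _ prod_le2[OF b(1,2) refl]] integrable_dom[OF _ prod_le2[OF b(3,2) refl]]
        integrable_dom[OF _ prod_le2[OF b(4,1) refl]] integrable_dom[OF _ prod_le2[OF b(3,4) refl]]; simp)+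
  have 1: "\<bar>(LINT x|Q. f1 x * g0 x) - (LINT x|Q. f1 x) * (LINT x|Q. g0 x)
           + (LINT x|Q. (d \<bullet> x) * (h \<bullet> x))\<bar> \<le> K\<^sup>2 * (3 * mo 3 + mo 1 * mo 2) * (\<tau> * norm d)"
    unfolding f1_def g0_def by (rule cov_perturb[OF \<tau> K(1,3,2)])
  have 2: "\<bar>(LINT x|Q. g1 x * f0 x) - (LINT x|Q. g1 x) * (LINT x|Q. f0 x)
           + (LINT x|Q. (D \<bullet> x) * (z \<bullet> x))\<bar> \<le> K\<^sup>2 * (3 * mo 3 + mo 1 * mo 2) * (\<tau> * norm D)"
    unfolding g1_def f0_def by (rule cov_perturb[OF \<tau> K(2,4,1)])
  have 3: "\<bar>LINT x|Q. f1 x * g1 x\<bar> \<le> norm d * norm D * mo 2"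
    by (rule integral_dom[OF _ prod_le2[OF b(3,4)]]) auto
  have "\<bar>LINT x|Q. f1 x\<bar> \<le> norm d * mo 1" "\<bar>LINT x|Q. g1 x\<bar> \<le> norm D * mo 1"
    using b by (auto intro!: integral_dom)
  then have 4: "\<bar>(LINT x|Q. f1 x) * (LINT x|Q. g1 x)\<bar> \<le> (norm d * mo 1) * (norm D * mo 1)"
    unfolding abs_mult by (intro mult_mono) (auto intro: order_trans[OF abs_ge_zero])
  have 5: "(LINT x|Q. f0 x * g0 x) = (LINT x|Q. f0 x) * (LINT x|Q. g0 x)"
    using uncorr by (simp add: f0_def g0_def)
  have "(LINT x|Q. f \<tau> x * g \<tau> x) = (LINT x|Q. f0 x * g0 x + f1 x * g0 x + g1 x * f0 x + f1 x * g1 x)"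
    unfolding f g by (intro Bochner_Integration.integral_cong) (auto simp: algebra_simps)
  also have "\<dots> = (LINT x|Q. f0 x * g0 x) + (LINT x|Q. f1 x * g0 x) + (LINT x|Q. g1 x * f0 x) + (LINT x|Q. f1 x * g1 x)"
    using I2 by simp
  finally have fg: "(LINT x|Q. f \<tau> x * g \<tau> x) = \<dots>" .
  have fg': "(LINT x|Q. f \<tau> x) = (LINT x|Q. f0 x) + (LINT x|Q. f1 x)"
     "(LINT x|Q. g \<tau> x) = (LINT x|Q. g0 x) + (LINT x|Q. g1 x)"
    unfolding f g using I1 by simp_all
  have eq: "?L = ((LINT x|Q. f1 x * g0 x) - (LINT x|Q. f1 x) * (LINT x|Q. g0 x)
           + (LINT x|Q. (d \<bullet> x) * (h \<bullet> x))) + ((LINT x|Q. g1 x * f0 x) - (LINT x|Q. g1 x) * (LINT x|Q. f0 x)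
           + (LINT x|Q. (D \<bullet> x) * (z \<bullet> x))) + (LINT x|Q. f1 x * g1 x) - (LINT x|Q. f1 x) * (LINT x|Q. g1 x)"
    unfolding fg fg' 5 by (simp add: algebra_simps)
  have "\<bar>?L\<bar> \<le> K\<^sup>2 * (3 * mo 3 + mo 1 * mo 2) * (\<tau> * norm d) + K\<^sup>2 * (3 * mo 3 + mo 1 * mo 2) * (\<tau> * norm D)
     + norm d * norm D * mo 2 + (norm d * mo 1) * (norm D * mo 1)"
    unfolding eq using 1 2 3 4 by linarith
  also have "\<dots> = ?R" by (simp add: algebra_simps power2_eq_square)
  finally show ?thesis .
qed

text \<open>The truncation deviates from a mean-zero linear form by at most \<open>\<tau>\<close>
  times a quadratic. Small means are needed because the change of a product of means contains the
  change of one mean, of order \<open>\<gamma>\<close>, times the other mean.\<close>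

lemma rsin_mean_le:
  fixes z d :: 'a
  assumes \<tau>: "0 < \<tau>" and K: "norm z \<le> K" "norm d \<le> K" "0 \<le> K"
  shows "\<bar>LINT x|Q. rsin \<tau> (z \<bullet> x - d \<bullet> x)\<bar> \<le> \<tau> * (4 * K\<^sup>2 * mo 2)"
    and "\<bar>LINT x|Q. rsin \<tau> (z \<bullet> x - d \<bullet> x) * S x\<bar> \<le> 2 * K * moS 1"
proof -
  let ?f = "\<lambda>x. rsin \<tau> (z \<bullet> x - d \<bullet> x)"
  have w: "\<bar>z \<bullet> x - d \<bullet> x\<bar> \<le> 2 * K * norm x ^ 1" for x
    using inner_le[OF K(1), of x] inner_le[OF K(2), of x] unfolding power_one_right by linarith
  have f1: "\<bar>?f x\<bar> \<le> 2 * K * norm x ^ 1" for x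
    by (rule order_trans[OF rsin_le[OF \<tau>] w])
  have f2: "\<bar>?f x - (z \<bullet> x - d \<bullet> x)\<bar> \<le> \<tau> * (4 * K\<^sup>2) * norm x ^ 2" for x
  proof -
    have "(z \<bullet> x - d \<bullet> x)\<^sup>2 \<le> (2 * K * norm x)\<^sup>2" using w[of x] by (intro abs_le_square_iff[THEN iffD1]) simp
    then show ?thesis
      by (intro order_trans[OF rsin_approx[OF \<tau>]]) (use \<tau> in \<open>simp add: power_mult_distrib mult.assoc\<close>)
  qed
  have "integrable Q ?f" by (rule integrable_dom[OF _ f1]) auto
  moreover have I: "integrable Q (\<lambda>x. z \<bullet> x)" "integrable Q (\<lambda>x. d \<bullet> x)"
    using inner_le[OF K(1)] inner_le[OF K(2)] by (auto intro!: integrable_dom[of _ K 1])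
  ultimately have "(LINT x|Q. ?f x) = (LINT x|Q. ?f x - (z \<bullet> x - d \<bullet> x))"
    by (simp add: mean0)
  then show "\<bar>LINT x|Q. ?f x\<bar> \<le> \<tau> * (4 * K\<^sup>2 * mo 2)"
    using integral_dom[OF _ f2] by (auto simp: mult.assoc)
  show "\<bar>LINT x|Q. ?f x * S x\<bar> \<le> 2 * K * moS 1"
    by (rule integral_dom_score[OF _ f1]) auto
qed

end

section \<open>The moment equation along a path\<close>

text \<open>The constant \<open>C\<close> does not depend on \<open>\<tau>\<close>, whereas the
  neighbourhood of 0 for \<open>\<gamma>\<close> may. Errors are measured against
  \<open>\<bar>\<gamma>\<bar> + l \<gamma> * norm (\<Delta> \<gamma>)\<close>, since nothing is
  known yet about the size of \<open>\<Delta>\<close>.\<close>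

lemma (in fourth_moment) moment_equation_aux:
  fixes P :: "real \<Rightarrow> 'a measure" and z h :: 'a and \<delta> \<Delta> :: "real \<Rightarrow> 'a"
  defines "l \<equiv> \<lambda>\<gamma>. 1 / (1 + norm (\<Delta> \<gamma>))"
  assumes qmd: "qmd_with_score P S" and P0: "P 0 = Q"
    and indep0: "\<And>s t. (LINT x|Q. sin (s * (z \<bullet> x)) * sin (t * (h \<bullet> x)))
        = (LINT x|Q. sin (s * (z \<bullet> x))) * (LINT x|Q. sin (t * (h \<bullet> x)))"
    and indep: "\<forall>\<^sub>F \<gamma> in at 0. \<forall>s t. (LINT x|P \<gamma>. sin (s * ((z - \<delta> \<gamma>) \<bullet> x)) * sin (t * ((h - \<Delta> \<gamma>) \<bullet> x)))
        = (LINT x|P \<gamma>. sin (s * ((z - \<delta> \<gamma>) \<bullet> x))) * (LINT x|P \<gamma>. sin (t * ((h - \<Delta> \<gamma>) \<bullet> x)))"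
    and \<delta>: "\<forall>\<^sub>F \<gamma> in at 0. norm (\<delta> \<gamma>) \<le> K0 * \<bar>\<gamma>\<bar>"
  shows "\<exists>C\<ge>0. \<forall>\<tau>. 0 < \<tau> \<and> \<tau> \<le> 1 \<longrightarrow> (\<forall>\<^sub>F \<gamma> in at 0.
      l \<gamma> * \<bar>\<gamma> * (LINT x|Q. (z \<bullet> x) * (h \<bullet> x) * S x) - (LINT x|Q. (\<delta> \<gamma> \<bullet> x) * (h \<bullet> x))
          - (LINT x|Q. (z \<bullet> x) * (\<Delta> \<gamma> \<bullet> x))\<bar>
        \<le> C * (\<tau> + tail_score \<tau> + \<bar>\<gamma>\<bar>) * (\<bar>\<gamma>\<bar> + l \<gamma> * norm (\<Delta> \<gamma>)))"
proof -
  define K where "K = 1 + norm z + norm h + \<bar>K0\<bar>"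
  define B where "B = 4 * K\<^sup>2 * mo 2"
  define s where "s = 2 * K * moS 1"
  define C1 where "C1 = K\<^sup>2 * (3 * mo 3 + mo 1 * mo 2)"
  define C2 where "C2 = mo 2 + (mo 1)\<^sup>2"
  define c1 where "c1 = C1 * K + 1 + 2 * B * (s + 1)"
  define c2 where "c2 = 6 * K^3"
  define c3 where "c3 = 2 * K * K * moS 2 + (s + 1)\<^sup>2 + C2 * K"
  have K: "norm z \<le> K" "norm h \<le> K" "1 \<le> K" "K0 \<le> K" "0 \<le> K" 
    using norm_ge_zero[of z] norm_ge_zero[of h] abs_ge_self[of K0] unfolding K_def by linarith+
  have nn: "0 \<le> B" "0 \<le> s" "0 \<le> C1" "0 \<le> C2" "0 \<le> c1" "0 \<le> c2" "0 \<le> c3"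
    using K by (auto simp: B_def s_def C1_def C2_def c1_def c2_def c3_def mo_nonneg moS_nonneg)
  show ?thesis
  proof (intro exI[of _ "c1 + c2 + c3"] conjI allI impI)
    show "0 \<le> c1 + c2 + c3" using nn by simp
    fix \<tau> :: real assume "0 < \<tau> \<and> \<tau> \<le> 1"
    then have \<tau>: "0 < \<tau>" "\<tau> \<le> 1" by auto
    have "\<forall>\<^sub>F \<gamma> in at (0::real). \<bar>\<gamma>\<bar> < 1"
      by (intro order_tendstoD(2)[where y = 0]) (auto intro!: tendsto_eq_intros)
    then show "\<forall>\<^sub>F \<gamma> in at 0.
      l \<gamma> * \<bar>\<gamma> * (LINT x|Q. (z \<bullet> x) * (h \<bullet> x) * S x) - (LINT x|Q. (\<delta> \<gamma> \<bullet> x) * (h \<bullet> x))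
          - (LINT x|Q. (z \<bullet> x) * (\<Delta> \<gamma> \<bullet> x))\<bar>
        \<le> (c1 + c2 + c3) * (\<tau> + tail_score \<tau> + \<bar>\<gamma>\<bar>) * (\<bar>\<gamma>\<bar> + l \<gamma> * norm (\<Delta> \<gamma>))"
      using indep \<delta> qmd_expansion[OF qmd prob_space_axioms[folded P0] zero_less_power[OF \<tau>(1), of 3]]
    proof (eventually_elim, goal_cases)
      case (1 \<gamma>)
      note E = 1(4)[rule_format, unfolded P0]
      \<comment> \<open>Scaling the whole error form by \<open>l \<gamma>\<close> moves the
        increment into the unit ball. The factor can be absorbed into the frequency \<open>t\<close>
        of the sine, so the factorization of the expectations survives.\<close>
      define D where "D = l \<gamma> *\<^sub>R \<Delta> \<gamma>"
      define h' where "h' = l \<gamma> *\<^sub>R h"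
      have l: "0 < l \<gamma>" "l \<gamma> \<le> 1"
        by (auto simp: l_def add_pos_nonneg divide_le_eq_1)
      have "l \<gamma> * norm (\<Delta> \<gamma>) \<le> 1"
        by (simp add: l_def divide_le_eq_1 add_pos_nonneg)
      then have D: "norm D = l \<gamma> * norm (\<Delta> \<gamma>)" "norm D \<le> 1" "norm D \<le> K"
        using l K by (auto simp: D_def)
      have h': "norm h' \<le> K"
        using l K mult_mono[of "l \<gamma>" 1 "norm h" K] by (simp add: h'_def)
      have d0: "norm (\<delta> \<gamma>) \<le> K * \<bar>\<gamma>\<bar>"
        using 1(3) K(4) by (meson abs_ge_zero mult_right_mono order_trans)
      then have d: "norm (\<delta> \<gamma>) \<le> K"
        using mult_left_le[of "\<bar>\<gamma>\<bar>" K] 1(1) K by linarith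
      define f where "f = (\<lambda>x. rsin \<tau> (z \<bullet> x - \<delta> \<gamma> \<bullet> x))"
      define g where "g = (\<lambda>x. rsin \<tau> (h' \<bullet> x - D \<bullet> x))"
      have [measurable]: "f \<in> borel_measurable borel" "g \<in> borel_measurable borel"
        unfolding f_def g_def by measurable
      define a b c where "a = (LINT x|Q. f x * g x)" and "b = (LINT x|Q. f x)" and "c = (LINT x|Q. g x)"
      define a' b' c' where "a' = (LINT x|P \<gamma>. f x * g x)" and "b' = (LINT x|P \<gamma>. f x)"
        and "c' = (LINT x|P \<gamma>. g x)"
      define X where "X = (LINT x|Q. f x * g x * S x)"
      define R where "R = (LINT x|Q. (z \<bullet> x) * (h' \<bullet> x) * S x)"
      define U where "U = (LINT x|Q. (\<delta> \<gamma> \<bullet> x) * (h' \<bullet> x)) + (LINT x|Q. (z \<bullet> x) * (D \<bullet> x))"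
      have f_sin: "f x = sin (\<tau> * ((z - \<delta> \<gamma>) \<bullet> x)) / \<tau>" for x
        by (simp add: f_def rsin_def inner_diff_left)
      have g_sin: "g x = sin (\<tau> * l \<gamma> * ((h - \<Delta> \<gamma>) \<bullet> x)) / \<tau>" for x
        by (simp add: g_def rsin_def h'_def D_def inner_diff_left right_diff_distrib mult.assoc)
      have prod': "a' = b' * c'"
        unfolding a'_def b'_def c'_def f_sin g_sin using 1(2)
        by simp
      have uncorr: "(LINT x|Q. rsin \<tau> (z \<bullet> x) * rsin \<tau> (h' \<bullet> x))
        = (LINT x|Q. rsin \<tau> (z \<bullet> x)) * (LINT x|Q. rsin \<tau> (h' \<bullet> x))"
        using indep0[of \<tau> "\<tau> * l \<gamma>"] by (simp add: rsin_def h'_def mult.assoc)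
      have fb: "\<bar>f x\<bar> \<le> 1 / \<tau>" and gb: "\<bar>g x\<bar> \<le> 1 / \<tau>" for x
        unfolding f_def g_def by (rule rsin_bounded[OF \<tau>(1)])+
      have fgb: "\<bar>f x * g x\<bar> \<le> 1 / \<tau> * (1 / \<tau>)" for x
        unfolding abs_mult by (rule mult_mono[OF fb gb]) (use \<tau> in auto)
      \<comment> \<open>The tolerance of the expansion was set to \<open>\<tau> ^ 3\<close> for this
        place: the product is bounded by \<open>1 / \<tau>\<^sup>2\<close>, which leaves an error
        \<open>\<tau> * \<bar>\<gamma>\<bar>\<close>. For a single factor the error is at most
        \<open>\<bar>\<gamma>\<bar>\<close>.\<close>
      have "\<bar>a' - a - \<gamma> * X\<bar> \<le> 1 / \<tau> * (1 / \<tau>) * \<tau> ^ 3 * \<bar>\<gamma>\<bar>"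
        unfolding a'_def a_def X_def by (rule E) (use fgb in auto)
      then have Ea: "\<bar>a' - a - \<gamma> * X\<bar> \<le> \<tau> * \<bar>\<gamma>\<bar>"
        using \<tau> by (simp add: power3_eq_cube)
      have t2: "1 / \<tau> * \<tau> ^ 3 * \<bar>\<gamma>\<bar> \<le> \<bar>\<gamma>\<bar>"
        using \<tau> mult_le_one[of \<tau> \<tau>] by (simp add: power3_eq_cube mult_left_le_one_le)
      have "\<bar>b' - b - \<gamma> * (LINT x|Q. f x * S x)\<bar> \<le> 1 / \<tau> * \<tau> ^ 3 * \<bar>\<gamma>\<bar>"
        unfolding b'_def b_def by (rule E) (use fb in auto)
      moreover have "\<bar>\<gamma> * (LINT x|Q. f x * S x)\<bar> \<le> \<bar>\<gamma>\<bar> * s"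
        unfolding abs_mult s_def f_def by (intro mult_left_mono rsin_mean_le[OF \<tau>(1) K(1) d K(5)]) simp
      ultimately have Eb: "\<bar>b' - b\<bar> \<le> (s + 1) * \<bar>\<gamma>\<bar>" using t2 unfolding distrib_right mult_1
        by (smt (verit) mult.commute)
      have "\<bar>c' - c - \<gamma> * (LINT x|Q. g x * S x)\<bar> \<le> 1 / \<tau> * \<tau> ^ 3 * \<bar>\<gamma>\<bar>"
        unfolding c'_def c_def by (rule E) (use gb in auto)
      moreover have "\<bar>\<gamma> * (LINT x|Q. g x * S x)\<bar> \<le> \<bar>\<gamma>\<bar> * s"
        unfolding abs_mult s_def g_def by (intro mult_left_mono rsin_mean_le[OF \<tau>(1) h' D(3) K(5)]) simp
      ultimately have Ec: "\<bar>c' - c\<bar> \<le> (s + 1) * \<bar>\<gamma>\<bar>" using t2 unfolding distrib_right mult_1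
        by (smt (verit) mult.commute)
      have bB: "\<bar>b\<bar> \<le> \<tau> * B"
        unfolding b_def B_def f_def by (rule rsin_mean_le[OF \<tau>(1) K(1) d K(5)])
      have cB: "\<bar>c\<bar> \<le> \<tau> * B"
        unfolding c_def B_def g_def by (rule rsin_mean_le[OF \<tau>(1) h' D(3) K(5)])
      have m1: "\<bar>(b' - b) * c\<bar> \<le> ((s + 1) * \<bar>\<gamma>\<bar>) * (\<tau> * B)"
        unfolding abs_mult by (rule mult_mono[OF Eb cB]) (use nn in auto)
      have m2: "\<bar>b * (c' - c)\<bar> \<le> (\<tau> * B) * ((s + 1) * \<bar>\<gamma>\<bar>)"
        unfolding abs_mult by (rule mult_mono[OF bB Ec]) (use nn \<tau> in auto)
      have m3: "\<bar>(b' - b) * (c' - c)\<bar> \<le> ((s + 1) * \<bar>\<gamma>\<bar>) * ((s + 1) * \<bar>\<gamma>\<bar>)"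
        unfolding abs_mult by (rule mult_mono[OF Eb Ec]) (use nn in auto)
      \<comment> \<open>The covariance \<open>a' - b' * c'\<close> at \<open>\<gamma>\<close> is
        zero, so the covariance \<open>a - b * c\<close> of the same functions under the law at 0 is
        \<open>- \<gamma> * X\<close> up to changes of the means.\<close>
      have "a - b * c + \<gamma> * X = - (a' - a - \<gamma> * X) + (b' - b) * c + b * (c' - c) + (b' - b) * (c' - c)"
        unfolding prod' by (simp add: algebra_simps)
      then have "\<bar>a - b * c + \<gamma> * X\<bar> \<le> \<tau> * \<bar>\<gamma>\<bar> + ((s + 1) * \<bar>\<gamma>\<bar>) * (\<tau> * B)
          + (\<tau> * B) * ((s + 1) * \<bar>\<gamma>\<bar>) + ((s + 1) * \<bar>\<gamma>\<bar>) * ((s + 1) * \<bar>\<gamma>\<bar>)"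
        using Ea m1 m2 m3 by linarith
      also have "\<dots> = \<tau> * \<bar>\<gamma>\<bar> + 2 * (B * (s + 1)) * (\<tau> * \<bar>\<gamma>\<bar>) + (s + 1)\<^sup>2 * (\<bar>\<gamma>\<bar> * \<bar>\<gamma>\<bar>)"
        by (simp add: power2_eq_square algebra_simps)
      finally have e1: "\<bar>a - b * c + \<gamma> * X\<bar> \<le> \<tau> * \<bar>\<gamma>\<bar> + 2 * (B * (s + 1)) * (\<tau> * \<bar>\<gamma>\<bar>) + (s + 1)\<^sup>2 * (\<bar>\<gamma>\<bar> * \<bar>\<gamma>\<bar>)" .
      have e2: "\<bar>a - b * c + U\<bar> \<le> C1 * (\<tau> * (norm (\<delta> \<gamma>) + norm D)) + C2 * (norm (\<delta> \<gamma>) * norm D)"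
        unfolding a_def b_def c_def U_def C1_def C2_def f_def g_def add.assoc[symmetric]
        by (rule cov_expansion[OF \<tau>(1) K(1) h' d D(3) K(3) uncorr])
      have e3: "\<bar>X - R\<bar> \<le> 2 * K * (norm (\<delta> \<gamma>) + norm D) * moS 2 + 6 * K^3 * tail_score \<tau>"
        unfolding X_def R_def f_def g_def by (rule score_perturb[OF \<tau>(1) K(1) h' d D(3) K(3)])
      define n where "n = \<bar>\<gamma>\<bar> + norm D"
      have n: "0 \<le> n" "\<bar>\<gamma>\<bar> \<le> n" "norm D \<le> n" by (auto simp: n_def)
      have dn: "norm (\<delta> \<gamma>) + norm D \<le> K * n"
        using d0 K mult_right_mono[of 1 K "norm D"] by (simp add: n_def distrib_left)
      \<comment> \<open>The covariance \<open>a - b * c\<close> has now been evaluated twice: as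
        \<open>- \<gamma> * X\<close> through the score and as \<open>- U\<close> through the
        shifts. Comparing the two eliminates it.\<close>
      have "\<bar>\<gamma> * R - U\<bar> = \<bar>(a - b * c + \<gamma> * X) - (a - b * c + U) - \<gamma> * (X - R)\<bar>"
        by (simp add: algebra_simps)
      then have t0: "\<bar>\<gamma> * R - U\<bar> \<le> \<bar>a - b * c + \<gamma> * X\<bar> + \<bar>a - b * c + U\<bar> + \<bar>\<gamma>\<bar> * \<bar>X - R\<bar>"
        unfolding abs_mult[symmetric] by linarith
      have t1: "\<bar>a - b * c + \<gamma> * X\<bar> \<le> (\<tau> + 2 * (B * (s + 1)) * \<tau> + (s + 1)\<^sup>2 * \<bar>\<gamma>\<bar>) * n"
        by (rule order_trans[OF e1], unfold distrib_right mult.assoc, intro add_mono mult_left_mono)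
           (use n nn \<tau> in auto)
      have t2: "\<bar>a - b * c + U\<bar> \<le> (C1 * K * \<tau> + C2 * K * \<bar>\<gamma>\<bar>) * n"
      proof (rule order_trans[OF e2])
        have "C1 * (\<tau> * (norm (\<delta> \<gamma>) + norm D)) \<le> C1 * (\<tau> * (K * n))"
          using dn nn \<tau> by (intro mult_left_mono) auto
        moreover have "C2 * (norm (\<delta> \<gamma>) * norm D) \<le> C2 * ((K * \<bar>\<gamma>\<bar>) * n)"
          using nn d0 n K by (intro mult_left_mono mult_mono) auto
        ultimately show "C1 * (\<tau> * (norm (\<delta> \<gamma>) + norm D)) + C2 * (norm (\<delta> \<gamma>) * norm D)
            \<le> (C1 * K * \<tau> + C2 * K * \<bar>\<gamma>\<bar>) * n"
          by (simp add: algebra_simps)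
      qed
      have t3: "\<bar>\<gamma>\<bar> * \<bar>X - R\<bar> \<le> (2 * K * K * moS 2 * \<bar>\<gamma>\<bar> + c2 * tail_score \<tau>) * n"
      proof -
        have "\<bar>\<gamma>\<bar> * \<bar>X - R\<bar> \<le> \<bar>\<gamma>\<bar> * (2 * K * (norm (\<delta> \<gamma>) + norm D) * moS 2 + 6 * K^3 * tail_score \<tau>)"
          by (intro mult_left_mono e3) simp
        also have "\<dots> = \<bar>\<gamma>\<bar> * (2 * K * (norm (\<delta> \<gamma>) + norm D) * moS 2) + \<bar>\<gamma>\<bar> * (c2 * tail_score \<tau>)"
          by (simp add: distrib_left c2_def)
        also have "\<dots> \<le> \<bar>\<gamma>\<bar> * (2 * K * (K * n) * moS 2) + n * (c2 * tail_score \<tau>)"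
          using dn K n nn \<tau> tail_score_nonneg[of \<tau>] moS_nonneg[of 2]
          by (intro add_mono mult_left_mono mult_right_mono) auto
        finally show ?thesis by (simp add: algebra_simps)
      qed
      have "\<bar>\<gamma> * R - U\<bar> \<le> (c1 * \<tau> + c2 * tail_score \<tau> + c3 * \<bar>\<gamma>\<bar>) * n"
        using t0 t1 t2 t3 by (simp add: c1_def c3_def algebra_simps)
      also have "\<dots> \<le> ((c1 + c2 + c3) * (\<tau> + tail_score \<tau> + \<bar>\<gamma>\<bar>)) * n"
      proof (rule mult_right_mono[OF _ n(1)])
        have "c1 * \<tau> + c2 * tail_score \<tau> + c3 * \<bar>\<gamma>\<bar>
          \<le> (c1 + c2 + c3) * \<tau> + (c1 + c2 + c3) * tail_score \<tau> + (c1 + c2 + c3) * \<bar>\<gamma>\<bar>"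
          using nn \<tau> tail_score_nonneg[of \<tau>] by (intro add_mono mult_right_mono) auto
        then show "c1 * \<tau> + c2 * tail_score \<tau> + c3 * \<bar>\<gamma>\<bar> \<le> (c1 + c2 + c3) * (\<tau> + tail_score \<tau> + \<bar>\<gamma>\<bar>)"
          by (simp only: distrib_left)
      qed
      finally have fin: "\<bar>\<gamma> * R - U\<bar> \<le> \<dots>" .
      \<comment> \<open>Both sides are linear in the scaled error form, so the factor
        \<open>l \<gamma>\<close> comes out again.\<close>
      have R: "R = l \<gamma> * (LINT x|Q. (z \<bullet> x) * (h \<bullet> x) * S x)"
        unfolding R_def h'_def by (simp add: mult.left_commute mult.assoc flip: integral_mult_right_zero)
      have U: "U = l \<gamma> * (LINT x|Q. (\<delta> \<gamma> \<bullet> x) * (h \<bullet> x)) + l \<gamma> * (LINT x|Q. (z \<bullet> x) * (\<Delta> \<gamma> \<bullet> x))"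
        unfolding U_def h'_def D_def by (simp add: mult.left_commute mult.assoc flip: integral_mult_right_zero)
      have "\<bar>\<gamma> * R - U\<bar> = l \<gamma> * \<bar>\<gamma> * (LINT x|Q. (z \<bullet> x) * (h \<bullet> x) * S x) - (LINT x|Q. (\<delta> \<gamma> \<bullet> x) * (h \<bullet> x))
          - (LINT x|Q. (z \<bullet> x) * (\<Delta> \<gamma> \<bullet> x))\<bar>"
      proof -
        have "\<gamma> * R - U = l \<gamma> * (\<gamma> * (LINT x|Q. (z \<bullet> x) * (h \<bullet> x) * S x) - (LINT x|Q. (\<delta> \<gamma> \<bullet> x) * (h \<bullet> x))
          - (LINT x|Q. (z \<bullet> x) * (\<Delta> \<gamma> \<bullet> x)))"
          unfolding R U by (simp only: right_diff_distrib diff_diff_eq distrib_left mult.left_commute)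
        then show ?thesis using l by (simp only: abs_mult abs_of_pos)
      qed
      then show ?case using fin by (simp only: n_def D(1))
    qed
  qed
qed

text \<open>Given the tolerance, \<open>\<tau>\<close> is fixed first so that
  \<open>C * (\<tau> + tail_score \<tau>)\<close> uses less than half of it; then
  \<open>\<gamma>\<close> is made small for the other half.\<close>

lemma (in fourth_moment) moment_equation:
  fixes P :: "real \<Rightarrow> 'a measure" and z h :: 'a and \<delta> \<Delta> :: "real \<Rightarrow> 'a"
  defines "l \<equiv> \<lambda>\<gamma>. 1 / (1 + norm (\<Delta> \<gamma>))"
  assumes qmd: "qmd_with_score P S" and P0: "P 0 = Q"
    and indep0: "\<And>s t. (LINT x|Q. sin (s * (z \<bullet> x)) * sin (t * (h \<bullet> x)))
        = (LINT x|Q. sin (s * (z \<bullet> x))) * (LINT x|Q. sin (t * (h \<bullet> x)))"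
    and indep: "\<forall>\<^sub>F \<gamma> in at 0. \<forall>s t. (LINT x|P \<gamma>. sin (s * ((z - \<delta> \<gamma>) \<bullet> x)) * sin (t * ((h - \<Delta> \<gamma>) \<bullet> x)))
        = (LINT x|P \<gamma>. sin (s * ((z - \<delta> \<gamma>) \<bullet> x))) * (LINT x|P \<gamma>. sin (t * ((h - \<Delta> \<gamma>) \<bullet> x)))"
    and \<delta>: "\<forall>\<^sub>F \<gamma> in at 0. norm (\<delta> \<gamma>) \<le> K0 * \<bar>\<gamma>\<bar>"
  shows "(\<lambda>\<gamma>. l \<gamma> * (\<gamma> * (LINT x|Q. (z \<bullet> x) * (h \<bullet> x) * S x) - (LINT x|Q. (\<delta> \<gamma> \<bullet> x) * (h \<bullet> x))
          - (LINT x|Q. (z \<bullet> x) * (\<Delta> \<gamma> \<bullet> x)))) \<in> o[at 0](\<lambda>\<gamma>. \<bar>\<gamma>\<bar> + l \<gamma> * norm (\<Delta> \<gamma>))"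
proof (rule landau_o.smallI)
  fix \<epsilon> :: real assume \<epsilon>: "0 < \<epsilon>"
  have l: "0 \<le> l \<gamma>" for \<gamma> by (simp add: l_def)
  obtain C where C: "0 \<le> C" and ev: "\<And>\<tau>. 0 < \<tau> \<Longrightarrow> \<tau> \<le> 1 \<Longrightarrow> (\<forall>\<^sub>F \<gamma> in at 0.
      l \<gamma> * \<bar>\<gamma> * (LINT x|Q. (z \<bullet> x) * (h \<bullet> x) * S x) - (LINT x|Q. (\<delta> \<gamma> \<bullet> x) * (h \<bullet> x))
          - (LINT x|Q. (z \<bullet> x) * (\<Delta> \<gamma> \<bullet> x))\<bar>
        \<le> C * (\<tau> + tail_score \<tau> + \<bar>\<gamma>\<bar>) * (\<bar>\<gamma>\<bar> + l \<gamma> * norm (\<Delta> \<gamma>)))"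
    using moment_equation_aux[OF qmd P0 indep0 indep \<delta>] unfolding l_def by blast
  have "(\<lambda>n. C * (inverse (real (Suc n)) + tail_score (inverse (real (Suc n))))) \<longlonglongrightarrow> C * (0 + 0)"
    by (intro tendsto_intros LIMSEQ_inverse_real_of_nat tail_score_tendsto)
  then have "\<forall>\<^sub>F n in sequentially. C * (inverse (real (Suc n)) + tail_score (inverse (real (Suc n)))) < \<epsilon> / 2"
    using \<epsilon> by (intro order_tendstoD(2)) auto
  then obtain n where n: "C * (inverse (real (Suc n)) + tail_score (inverse (real (Suc n)))) < \<epsilon> / 2"
    using eventually_happens'[OF sequentially_bot] by blast
  define \<tau> where "\<tau> = inverse (real (Suc n))"
  have \<tau>: "0 < \<tau>" "\<tau> \<le> 1" by (auto simp: \<tau>_def inverse_eq_divide)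
  have "\<forall>\<^sub>F \<gamma> in at (0::real). C * \<bar>\<gamma>\<bar> < \<epsilon> / 2"
    using \<epsilon> by (intro order_tendstoD(2)[where y = 0]) (auto intro!: tendsto_eq_intros)
  with ev[OF \<tau>] show "\<forall>\<^sub>F \<gamma> in at 0.
      norm (l \<gamma> * (\<gamma> * (LINT x|Q. (z \<bullet> x) * (h \<bullet> x) * S x) - (LINT x|Q. (\<delta> \<gamma> \<bullet> x) * (h \<bullet> x))
          - (LINT x|Q. (z \<bullet> x) * (\<Delta> \<gamma> \<bullet> x)))) \<le> \<epsilon> * norm (\<bar>\<gamma>\<bar> + l \<gamma> * norm (\<Delta> \<gamma>))"
  proof eventually_elim
    case (elim \<gamma>)
    have "C * (\<tau> + tail_score \<tau> + \<bar>\<gamma>\<bar>) \<le> \<epsilon>"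
      using n elim(2) unfolding \<tau>_def[symmetric] by (simp add: distrib_left)
    then have "C * (\<tau> + tail_score \<tau> + \<bar>\<gamma>\<bar>) * (\<bar>\<gamma>\<bar> + l \<gamma> * norm (\<Delta> \<gamma>)) \<le> \<epsilon> * (\<bar>\<gamma>\<bar> + l \<gamma> * norm (\<Delta> \<gamma>))"
      using l by (intro mult_right_mono) auto
    then show ?case using elim(1) l by (simp add: abs_mult)
  qed
qed

text \<open>After multiplication by \<open>1 + norm (\<Delta> \<gamma>)\<close> the hypothesis
  bounds \<open>\<Delta> \<gamma> - \<gamma> *\<^sub>R D\<close> by a small multiple of
  \<open>\<bar>\<gamma>\<bar> + 2 * norm (\<Delta> \<gamma>)\<close> once
  \<open>\<bar>\<gamma>\<bar> < 1\<close>. A first use with a fixed tolerance gives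
  \<open>norm (\<Delta> \<gamma>) = O(\<gamma>)\<close>, hence continuity at 0; a second use with an
  arbitrary tolerance gives the derivative.\<close>

lemma has_vector_derivative_damped:
  fixes \<Delta> :: "real \<Rightarrow> real^'n"
  defines "l \<equiv> \<lambda>\<gamma>. 1 / (1 + norm (\<Delta> \<gamma>))"
  assumes zero: "\<Delta> 0 = 0"
    and o: "\<And>p. (\<lambda>\<gamma>. l \<gamma> * (\<Delta> \<gamma> $ p - \<gamma> * D $ p)) \<in> o[at 0](\<lambda>\<gamma>. \<bar>\<gamma>\<bar> + l \<gamma> * norm (\<Delta> \<gamma>))"
  shows "(\<Delta> has_vector_derivative D) (at 0)"
proof -
  have l: "0 < l \<gamma>" for \<gamma> by (simp add: l_def add_pos_nonneg)
  have damped: "\<forall>\<^sub>F \<gamma> in at 0. norm (\<Delta> \<gamma> - \<gamma> *\<^sub>R D) \<le> \<epsilon> * (\<bar>\<gamma>\<bar> * (1 + norm (\<Delta> \<gamma>)) + norm (\<Delta> \<gamma>))"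
    if \<epsilon>: "0 < \<epsilon>" for \<epsilon>
  proof -
    define c where "c = \<epsilon> / CARD('n)"
    have c: "0 < c" using \<epsilon> by (simp add: c_def)
    have "\<forall>\<^sub>F \<gamma> in at 0. \<forall>p. norm (l \<gamma> * (\<Delta> \<gamma> $ p - \<gamma> * D $ p)) \<le> c * norm (\<bar>\<gamma>\<bar> + l \<gamma> * norm (\<Delta> \<gamma>))"
      by (intro eventually_all_finite landau_o.smallD[OF o c])
    then show ?thesis
    proof eventually_elim
      case (elim \<gamma>)
      have nn: "0 \<le> \<bar>\<gamma>\<bar> + l \<gamma> * norm (\<Delta> \<gamma>)" using l[of \<gamma>] by simp
      have "l \<gamma> * norm (\<Delta> \<gamma> - \<gamma> *\<^sub>R D) \<le> l \<gamma> * (\<Sum>p\<in>UNIV. \<bar>(\<Delta> \<gamma> - \<gamma> *\<^sub>R D) $ p\<bar>)"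
        using l[of \<gamma>] by (intro mult_left_mono norm_le_l1_cart) simp
      also have "\<dots> = (\<Sum>p\<in>UNIV. norm (l \<gamma> * (\<Delta> \<gamma> $ p - \<gamma> * D $ p)))"
        using l[of \<gamma>] by (simp add: sum_distrib_left abs_mult)
      also have "\<dots> \<le> (\<Sum>p\<in>(UNIV::'n set). c * (\<bar>\<gamma>\<bar> + l \<gamma> * norm (\<Delta> \<gamma>)))"
        using elim nn by (intro sum_mono) (metis real_norm_def abs_of_nonneg)
      also have "\<dots> = \<epsilon> * (\<bar>\<gamma>\<bar> + l \<gamma> * norm (\<Delta> \<gamma>))" by (simp add: c_def)
      finally have "l \<gamma> * norm (\<Delta> \<gamma> - \<gamma> *\<^sub>R D) \<le> \<epsilon> * (\<bar>\<gamma>\<bar> + l \<gamma> * norm (\<Delta> \<gamma>))" .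
      then have *: "(1 + norm (\<Delta> \<gamma>)) * (l \<gamma> * norm (\<Delta> \<gamma> - \<gamma> *\<^sub>R D))
          \<le> (1 + norm (\<Delta> \<gamma>)) * (\<epsilon> * (\<bar>\<gamma>\<bar> + l \<gamma> * norm (\<Delta> \<gamma>)))"
        by (rule mult_left_mono) simp
      have 1: "(1 + norm (\<Delta> \<gamma>)) * (l \<gamma> * x) = x" for x
        using norm_ge_zero[of "\<Delta> \<gamma>"] unfolding l_def by (simp add: add_nonneg_eq_0_iff)
      have eq: "(1 + norm (\<Delta> \<gamma>)) * (\<epsilon> * (\<bar>\<gamma>\<bar> + l \<gamma> * norm (\<Delta> \<gamma>)))
          = \<epsilon> * ((1 + norm (\<Delta> \<gamma>)) * \<bar>\<gamma>\<bar> + (1 + norm (\<Delta> \<gamma>)) * (l \<gamma> * norm (\<Delta> \<gamma>)))"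
        by (simp only: distrib_left mult.left_commute)
      show ?case using * unfolding 1 eq unfolding 1 mult.commute[of "\<bar>\<gamma>\<bar>"] .
    qed
  qed
  define d where "d = norm D"
  have lim: "((\<lambda>\<gamma>. norm (\<Delta> (0 + \<gamma>) - \<Delta> 0 - \<gamma> *\<^sub>R D) / norm \<gamma>) \<longlongrightarrow> 0) (at 0)"
  proof (rule tendstoI)
    fix e :: real assume e: "0 < e"
    \<comment> \<open>Inserting \<open>norm (\<Delta> \<gamma>) \<le> \<bar>\<gamma>\<bar> * (2 * d
      + 1)\<close> into \<open>\<bar>\<gamma>\<bar> + 2 * norm (\<Delta> \<gamma>)\<close> produces
      \<open>4 * d + 3\<close>; the factor 2 makes the final inequality strict.\<close>
    define \<epsilon> where "\<epsilon> = e / (2 * (4 * d + 3))"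
    have d: "0 < 4 * d + 3" by (simp add: d_def add_nonneg_pos)
    have \<epsilon>: "0 < \<epsilon>" using e d by (simp add: \<epsilon>_def)
    have "\<forall>\<^sub>F \<gamma> in at (0::real). \<bar>\<gamma>\<bar> < 1"
      by (intro order_tendstoD(2)[where y = 0]) (auto intro!: tendsto_eq_intros)
    moreover have "\<forall>\<^sub>F \<gamma> in at (0::real). \<gamma> \<noteq> 0" by (simp add: eventually_at_filter)
    ultimately show "\<forall>\<^sub>F \<gamma> in at 0. dist (norm (\<Delta> (0 + \<gamma>) - \<Delta> 0 - \<gamma> *\<^sub>R D) / norm \<gamma>) 0 < e"
      using damped[of "1 / 4", OF divide_pos_pos[OF zero_less_one zero_less_numeral]] damped[OF \<epsilon>]
    proof eventually_elim
      case (elim \<gamma>)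
      let ?D = "norm (\<Delta> \<gamma>)"
      have gD: "\<bar>\<gamma>\<bar> * ?D \<le> ?D" using elim(1) by (intro mult_left_le_one_le) auto
      have "?D \<le> norm (\<Delta> \<gamma> - \<gamma> *\<^sub>R D) + \<bar>\<gamma>\<bar> * d"
        unfolding d_def using norm_triangle_sub[of "\<Delta> \<gamma>" "\<gamma> *\<^sub>R D"] by simp
      \<comment> \<open>With tolerance 1/4 the right-hand side contains at most half of
        \<open>?D\<close>, which is absorbed on the left.\<close>
      then have D: "?D \<le> \<bar>\<gamma>\<bar> * (2 * d + 1)"
        using elim(3) gD by (simp add: distrib_left)
      have "norm (\<Delta> \<gamma> - \<gamma> *\<^sub>R D) \<le> \<epsilon> * (\<bar>\<gamma>\<bar> + 2 * ?D)"
        using gD \<epsilon> by (intro order_trans[OF elim(4)] mult_left_mono) (auto simp: distrib_left)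
      also have "\<dots> \<le> \<epsilon> * (\<bar>\<gamma>\<bar> + 2 * (\<bar>\<gamma>\<bar> * (2 * d + 1)))"
        using D \<epsilon> by (intro mult_left_mono) auto
      also have "\<dots> = \<epsilon> * (4 * d + 3) * \<bar>\<gamma>\<bar>" by (simp add: algebra_simps)
      also have "\<dots> = e / 2 * \<bar>\<gamma>\<bar>" using d by (simp add: \<epsilon>_def field_simps)
      also have "\<dots> < e * \<bar>\<gamma>\<bar>" using e elim(2) by simp
      finally show ?case using elim(2) by (simp add: zero pos_divide_less_eq)
    qed
  qed
  show ?thesis
    unfolding has_vector_derivative_def has_derivative_at using lim
    by (simp add: bounded_linear_scaleR_left)
qed

lemma has_vector_derivative_smallo:
  fixes f :: "real \<Rightarrow> real"
  assumes "(f has_vector_derivative D) (at 0)"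
  shows "(\<lambda>\<gamma>. f \<gamma> - f 0 - \<gamma> * D) \<in> o[at 0](\<lambda>\<gamma>. \<bar>\<gamma>\<bar>)"
proof (rule smalloI_tendsto)
  have "((\<lambda>\<gamma>. norm (f (0 + \<gamma>) - f 0 - \<gamma> *\<^sub>R D) / norm \<gamma>) \<longlongrightarrow> 0) (at 0)"
    using assms unfolding has_vector_derivative_def has_derivative_at by blast
  then show "((\<lambda>\<gamma>. (f \<gamma> - f 0 - \<gamma> * D) / \<bar>\<gamma>\<bar>) \<longlongrightarrow> 0) (at 0)"
    by (subst tendsto_rabs_zero_iff[symmetric]) simp
  show "\<forall>\<^sub>F \<gamma> in at (0::real). \<bar>\<gamma>\<bar> \<noteq> 0" by (simp add: eventually_at_filter)
qed

section \<open>Independence of instruments and errors\<close>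

lemma coeff_zero: "\<beta> \<in> coeff_matrices G \<Longrightarrow> w \<notin> pa G v \<Longrightarrow> \<beta> $ w $ v = 0"
  by (simp add: coeff_matrices_def pa_def)

text \<open>The coefficient vector of the error of \<open>v\<close> as a linear form in X. Changing
  the coefficient matrix changes it additively, by minus the increment of column \<open>v\<close>;
  this turns a path of coefficients into a shift of linear forms.\<close>

definition noise_form :: "real^'v^'v \<Rightarrow> 'v \<Rightarrow> real^'v" where
  "noise_form \<beta> v = axis v 1 - column v \<beta>"

lemma eps_noise_form: "\<beta> \<in> coeff_matrices G \<Longrightarrow> eps G \<beta> v x = noise_form \<beta> v \<bullet> x"
proof -
  assume \<beta>: "\<beta> \<in> coeff_matrices G"
  have "column v \<beta> \<bullet> x = (\<Sum>w\<in>UNIV. \<beta> $ w $ v * x $ w)" by (simp add: inner_vec_def column_def)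
  also have "\<dots> = (\<Sum>w\<in>pa G v. \<beta> $ w $ v * x $ w)"
    by (rule sum.mono_neutral_right) (auto simp: coeff_zero[OF \<beta>])
  finally show ?thesis by (simp add: eps_def noise_form_def inner_diff_left inner_axis')
qed

abbreviation solution_matrix :: "real^'v^'v \<Rightarrow> real^'v^'v" where
  "solution_matrix \<beta> \<equiv> matrix_inv (transpose (mat 1 - \<beta>))"

lemma solution_matrix:
  assumes "\<beta> \<in> coeff_matrices G"
  shows "transpose (mat 1 - \<beta>) ** solution_matrix \<beta> = mat 1"
    and "solution_matrix \<beta> ** transpose (mat 1 - \<beta>) = mat 1"
proof -
  have "invertible (transpose (mat 1 - \<beta>))"
    using assms by (simp add: coeff_matrices_def invertible_det_nz det_transpose)
  then show "transpose (mat 1 - \<beta>) ** solution_matrix \<beta> = mat 1"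
    and "solution_matrix \<beta> ** transpose (mat 1 - \<beta>) = mat 1"
    unfolding invertible_def matrix_inv_def by (metis (mono_tags, lifting) someI_ex)+
qed

lemma noise_form_solution:
  assumes "\<beta> \<in> coeff_matrices G"
  shows "noise_form \<beta> v \<bullet> (solution_matrix \<beta> *v e) = e $ v"
proof -
  have "noise_form \<beta> v = row v (transpose (mat 1 - \<beta>))"
    by (simp add: row_transpose) (simp add: noise_form_def vec_eq_iff column_def mat_def axis_def)
  then have "noise_form \<beta> v \<bullet> (solution_matrix \<beta> *v e) = (transpose (mat 1 - \<beta>) *v (solution_matrix \<beta> *v e)) $ v"
    by (simp add: matrix_vector_mult_def row_def inner_vec_def)
  then show ?thesis
    by (simp add: matrix_vector_mul_assoc solution_matrix[OF assms])
qed

text \<open>The vectors supported on the vertices reachable from \<open>a\<close> form a subspace invariant under the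
  injective map \<open>transpose (mat 1 - \<beta>)\<close>, hence, by dimension, also under its inverse.\<close>

lemma solution_matrix_zero:
  fixes \<beta> :: "real^'v::finite^'v"
  assumes \<beta>: "\<beta> \<in> coeff_matrices G" and "(a, y) \<notin> (directed G)\<^sup>*"
  shows "solution_matrix \<beta> $ y $ a = 0"
proof -
  \<comment> \<open>With directed cycles the Neumann series of the inverse may diverge, so its
    entries cannot simply be read as sums over directed paths. The subspace argument avoids the
    series.\<close>
  define T where "T = {w. (a, w) \<in> (directed G)\<^sup>*}"
  define L where "L = {x :: real^'v. \<forall>w. w \<notin> T \<longrightarrow> x $ w = 0}"
  define f where "f = (\<lambda>x. transpose (mat 1 - \<beta>) *v x)"
  have lin: "linear f" unfolding f_def by (rule matrix_vector_mul_linear)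
  have inv: "solution_matrix \<beta> *v f x = x" for x
    by (simp only: f_def matrix_vector_mul_assoc solution_matrix[OF \<beta>] matrix_vector_mul_lid)
  then have inj: "inj f" by (metis injI)
  have sub: "subspace L" by (auto simp: L_def subspace_def)
  have "f x \<in> L" if x: "x \<in> L" for x
  proof -
    have "f x $ u = 0" if u: "u \<notin> T" for u
    proof -
      have "(mat 1 - \<beta>) $ w $ u * x $ w = 0" for w
      proof (cases "w \<in> T")
        case True
        then have "(w, u) \<notin> directed G" using u by (auto simp: T_def intro: rtrancl_into_rtrancl)
        then show ?thesis using \<beta> True u by (auto simp: coeff_matrices_def mat_def)
      qed (use x in \<open>simp add: L_def\<close>)
      then have "(\<Sum>w\<in>UNIV. (mat 1 - \<beta>) $ w $ u * x $ w) = 0" by (intro sum.neutral) blast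
      then show ?thesis by (simp add: f_def matrix_vector_mult_def transpose_def)
    qed
    then show ?thesis by (simp add: L_def)
  qed
  then have "f ` L \<subseteq> L" by auto
  moreover have "dim (f ` L) = dim L"
    by (rule dim_image_eq[OF lin]) (use inj in \<open>auto intro: inj_on_subset\<close>)
  ultimately have "f ` L = L"
    by (intro subspace_dim_equal linear_subspace_image lin sub) auto
  moreover have "axis a 1 \<in> L" by (auto simp: L_def T_def axis_def)
  ultimately obtain x where x: "x \<in> L" "axis a 1 = f x" by blast
  then have "solution_matrix \<beta> *v axis a 1 \<in> L" by (simp add: inv)
  moreover have "y \<notin> T" using assms by (simp add: T_def)
  ultimately have "(solution_matrix \<beta> *v axis a 1) $ y = 0" by (simp add: L_def)
  then show ?thesis by (simp add: matrix_vector_mult_basis column_def)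
qed

lemma rtrancl_successively:
  assumes "(a, b) \<in> r\<^sup>*"
  shows "\<exists>xs. xs \<noteq> [] \<and> hd xs = a \<and> last xs = b \<and> successively (\<lambda>x y. (x, y) \<in> r) xs"
  using assms
proof (induction rule: converse_rtrancl_induct)
  case base
  show ?case by (rule exI[of _ "[b]"]) simp
next
  case (step y z)
  then obtain xs where "xs \<noteq> []" "hd xs = z" "last xs = b" "successively (\<lambda>x y. (x, y) \<in> r) xs"
    by blast
  then show ?case using step(1) by (intro exI[of _ "y # xs"]) (simp add: successively_Cons)
qed

text \<open>A directed path starting at \<open>v\<close> is a half-trek, and so is one starting at a
  sibling of \<open>v\<close> once the bidirected edge is put in front. Hence for a witness outside
  \<open>htr G v\<close> the variable itself carries none of the errors that may depend on the error
  of \<open>v\<close>.\<close>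

lemma not_htr_unreachable:
  assumes "y \<notin> insert v (sib G v)" "y \<notin> htr G v" "a \<in> insert v (sib G v)"
  shows "(a, y) \<notin> (directed G)\<^sup>*"
proof
  assume "(a, y) \<in> (directed G)\<^sup>*"
  then obtain xs where xs: "xs \<noteq> []" "hd xs = a" "last xs = y"
      "successively (\<lambda>x y. (x, y) \<in> directed G) xs"
    using rtrancl_successively by metis
  have "\<exists>xs. half_trek G xs \<and> hd xs = v \<and> last xs = y"
  proof (cases "a = v")
    case True
    then show ?thesis using xs by (auto simp: half_trek_def)
  next
    case False
    then have "{v, a} \<in> bidirected G" using assms(3) by (auto simp: sib_def insert_commute)
    moreover obtain zs where "xs = a # zs" using xs by (cases xs) auto
    ultimately have "half_trek G (v # xs)" using xs unfolding half_trek_def by auto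
    then show ?thesis using xs by (intro exI[of _ "v # xs"]) auto
  qed
  then show False using assms by (auto simp: htr_def)
qed

lemma measurable_matrix_vector_mult [measurable]: "(\<lambda>e. (M :: real^'n^'m) *v e) \<in> borel_measurable borel"
  by (intro borel_measurable_continuous_onI linear_continuous_on) (rule matrix_vector_mul_bounded_linear)

lemma measurable_vec_nth [measurable]: "(\<lambda>e::real^'n. e $ i) \<in> borel_measurable borel"
  by (intro borel_measurable_continuous_onI continuous_intros)

definition instrument_form :: "'v mixed_graph \<Rightarrow> real^'v^'v \<Rightarrow> 'v \<Rightarrow> 'v \<Rightarrow> real^'v" where
  "instrument_form G \<beta> v y = (if y \<in> htr G v then noise_form \<beta> y else axis y 1)"

lemma instrument_form: "\<beta> \<in> coeff_matrices G \<Longrightarrow> instrument G \<beta> v y x = instrument_form G \<beta> v y \<bullet> x"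
  by (simp add: instrument_def instrument_form_def eps_noise_form inner_axis')

section \<open>Consequences of the error law\<close>

context
  fixes G :: "'v::finite mixed_graph" and N :: "(real^'v) measure"
  assumes G: "directed_mixed_graph G" and N: "error_law G N"
begin

interpretation N: prob_space N using N by (simp add: error_law_def)

lemma sets_error [measurable_cong]: "sets N = sets borel" using N by (simp add: error_law_def)

lemma measurable_solution: "(\<lambda>e. solution_matrix \<beta> *v e) \<in> N \<rightarrow>\<^sub>M borel"
  by measurable

lemma sets_model_dist: "sets (model_dist \<beta> N) = sets borel"
  by (simp add: model_dist_def)

lemma prob_space_model_dist: "prob_space (model_dist \<beta> N)"
  unfolding model_dist_def by (rule N.prob_space_distr[OF measurable_solution])

lemma integral_model_dist:
  fixes f :: "real^'v \<Rightarrow> real"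
  shows "f \<in> borel_measurable borel \<Longrightarrow> (LINT x|model_dist \<beta> N. f x) = (LINT e|N. f (solution_matrix \<beta> *v e))"
  unfolding model_dist_def by (rule integral_distr[OF measurable_solution])

lemma integrable_norm4: "integrable N (\<lambda>e. norm e ^ 4)"
proof (rule Bochner_Integration.integrable_bound)
  show "integrable N (\<lambda>e. \<Sum>i\<in>UNIV. \<Sum>j\<in>UNIV. (e $ i) ^ 4 + (e $ j) ^ 4)"
    using N by (intro Bochner_Integration.integrable_sum Bochner_Integration.integrable_add) (auto simp: error_law_def)
  have "norm e ^ 4 \<le> (\<Sum>i\<in>UNIV. \<Sum>j\<in>UNIV. (e $ i) ^ 4 + (e $ j) ^ 4)" for e :: "real^'v"
  proof -
    have "norm e ^ 4 = ((norm e)\<^sup>2)\<^sup>2" by simp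
    also have "\<dots> = (\<Sum>i\<in>UNIV. \<Sum>j\<in>UNIV. (e $ i)\<^sup>2 * (e $ j)\<^sup>2)"
      unfolding power2_norm_eq_inner by (simp add: inner_vec_def power2_eq_square sum_product)
    also have "\<dots> \<le> (\<Sum>i\<in>UNIV. \<Sum>j\<in>UNIV. (e $ i) ^ 4 + (e $ j) ^ 4)"
    proof (intro sum_mono)
      fix i j
      have "2 * (e $ i)\<^sup>2 * (e $ j)\<^sup>2 \<le> ((e $ i)\<^sup>2)\<^sup>2 + ((e $ j)\<^sup>2)\<^sup>2"
        by (rule sum_squares_bound)
      moreover have "0 \<le> (e $ i)\<^sup>2 * (e $ j)\<^sup>2" by simp
      ultimately have "(e $ i)\<^sup>2 * (e $ j)\<^sup>2 \<le> ((e $ i)\<^sup>2)\<^sup>2 + ((e $ j)\<^sup>2)\<^sup>2" by linarith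
      then show "(e $ i)\<^sup>2 * (e $ j)\<^sup>2 \<le> (e $ i) ^ 4 + (e $ j) ^ 4" by simp
    qed
    finally show ?thesis .
  qed
  then show "AE e in N. norm (norm e ^ 4) \<le> norm (\<Sum>i\<in>UNIV. \<Sum>j\<in>UNIV. (e $ i) ^ 4 + (e $ j) ^ 4)"
    by (auto intro!: always_eventually order_trans[OF _ abs_ge_self])
qed measurable

lemma integrable_error_component: "integrable N (\<lambda>e. e $ i)"
proof (rule Bochner_Integration.integrable_bound)
  show "integrable N (\<lambda>e. 1 + norm e ^ 4)" using integrable_norm4 by simp
  have "\<bar>e $ i\<bar> \<le> 1 + norm e ^ 4" for e :: "real^'v"
  proof -
    have "norm e \<le> 1 + norm e ^ 4"
      by (cases "norm e \<le> 1") (auto intro: add_increasing2 order_trans[OF self_le_power[of "norm e" 4]])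
    then show ?thesis using component_le_norm_cart[of e i] by simp
  qed
  then show "AE e in N. norm (e $ i) \<le> norm (1 + norm e ^ 4)" by auto
qed measurable

lemma mean_error_form: "(LINT e|N. c \<bullet> e) = 0"
  unfolding inner_vec_def using integrable_error_component N
  by (subst Bochner_Integration.integral_sum) (auto simp: error_law_def)

lemma fourth_moment_model_dist:
  assumes "S \<in> borel_measurable (model_dist \<beta> N)" "integrable (model_dist \<beta> N) (\<lambda>x. (S x)\<^sup>2)"
  shows "fourth_moment (model_dist \<beta> N) S"
proof (intro fourth_moment.intro fourth_moment_axioms.intro assms prob_space_model_dist sets_model_dist)
  let ?M = "solution_matrix \<beta>"
  obtain B where B: "norm (?M *v e) \<le> norm e * B" for e
    using bounded_linear.bounded[OF matrix_vector_mul_bounded_linear[of ?M]] by blast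
  have "integrable N (\<lambda>e. norm (?M *v e) ^ 4)"
  proof (rule Bochner_Integration.integrable_bound)
    show "integrable N (\<lambda>e. norm e ^ 4 * B ^ 4)" using integrable_norm4 by simp
    have "norm (?M *v e) ^ 4 \<le> (norm e * B) ^ 4" for e by (intro power_mono B) simp
    then show "AE e in N. norm (norm (?M *v e) ^ 4) \<le> norm (norm e ^ 4 * B ^ 4)"
      by (simp add: power_mult_distrib)
  qed measurable
  then show "integrable (model_dist \<beta> N) (\<lambda>x. norm x ^ 4)"
    unfolding model_dist_def by (subst integrable_distr_eq[OF measurable_solution]) auto
  fix w :: "real^'v"
  have "(LINT x|model_dist \<beta> N. w \<bullet> x) = (LINT e|N. (w v* ?M) \<bullet> e)"
    by (subst integral_model_dist) (auto simp: dot_lmul_matrix[symmetric])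
  then show "(LINT x|model_dist \<beta> N. w \<bullet> x) = 0" using mean_error_form by simp
qed

text \<open>A single vertex is connected in the bidirected part, so its error is independent of the
  joint vector of errors outside it and its siblings. The form \<open>c\<close> is a function of
  that vector.\<close>

lemma indep_error_form:
  assumes c: "\<And>a. a \<in> insert v (sib G v) \<Longrightarrow> c $ a = 0"
  shows "N.indep_var borel (\<lambda>e. e $ v) borel (\<lambda>e. c \<bullet> e)"
proof -
  define J where "J = - ({v} \<union> sib_set G {v})"
  have "bidir_connected G {v}" by (simp add: bidir_connected_def)
  then have "N.indep_var (PiM {v} (\<lambda>_. borel)) (\<lambda>e. \<lambda>i\<in>{v}. e $ i) (PiM J (\<lambda>_. borel)) (\<lambda>e. \<lambda>i\<in>J. e $ i)"
    using N unfolding error_law_def J_def by blast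
  then have "N.indep_var borel ((\<lambda>\<omega>. \<omega> v) \<circ> (\<lambda>e. \<lambda>i\<in>{v}. e $ i))
      borel ((\<lambda>\<omega>. \<Sum>i\<in>J. c $ i * \<omega> i) \<circ> (\<lambda>e. \<lambda>i\<in>J. e $ i))"
    by (rule N.indep_var_compose) (auto intro!: borel_measurable_sum borel_measurable_times)
  moreover have "(\<Sum>i\<in>J. c $ i * (\<lambda>i\<in>J. e $ i) i) = c \<bullet> e" for e
  proof -
    have "(\<Sum>i\<in>J. c $ i * (\<lambda>i\<in>J. e $ i) i) = (\<Sum>i\<in>J. c $ i * e $ i)" by simp
    also have "\<dots> = (\<Sum>i\<in>UNIV. c $ i * e $ i)"
    proof (rule sum.mono_neutral_left)
      have "i \<in> insert v (sib G v)" if "i \<notin> J" for i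
        using that by (auto simp: J_def sib_set_def sib_def)
      then show "\<forall>i\<in>UNIV - J. c $ i * e $ i = 0" using c by auto
    qed auto
    finally show ?thesis by (simp add: inner_vec_def)
  qed
  ultimately show ?thesis by (simp add: comp_def)
qed

text \<open>In both cases the instrument is a linear form in the errors that vanishes on
  \<open>v\<close> and its siblings: for \<open>y\<close> in \<open>htr G v\<close> it is the error
  of \<open>y\<close> alone, otherwise it is row \<open>y\<close> of the solution matrix, whose
  entries at vertices that do not reach \<open>y\<close> are zero.\<close>

lemma indep_instrument:
  assumes \<beta>: "\<beta> \<in> coeff_matrices G" and y: "y \<notin> insert v (sib G v)"
  shows "N.indep_var borel (\<lambda>e. noise_form \<beta> v \<bullet> (solution_matrix \<beta> *v e))
           borel (\<lambda>e. instrument_form G \<beta> v y \<bullet> (solution_matrix \<beta> *v e))"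
proof (cases "y \<in> htr G v")
  case True
  have "N.indep_var borel (\<lambda>e. e $ v) borel (\<lambda>e. axis y 1 \<bullet> e)"
    by (rule indep_error_form) (use y in \<open>auto simp: axis_def\<close>)
  then show ?thesis
    using True by (simp add: instrument_form_def noise_form_solution[OF \<beta>] inner_axis')
next
  case False
  have "N.indep_var borel (\<lambda>e. e $ v) borel (\<lambda>e. (solution_matrix \<beta> $ y) \<bullet> e)"
    using not_htr_unreachable[OF y False] by (intro indep_error_form solution_matrix_zero[OF \<beta>])
  moreover have "solution_matrix \<beta> $ y \<bullet> e = axis y 1 \<bullet> (solution_matrix \<beta> *v e)" for e
    by (simp add: inner_axis' matrix_vector_mul_component)
  ultimately show ?thesis
    using False by (simp add: instrument_form_def noise_form_solution[OF \<beta>])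
qed

text \<open>Two separate frequencies are needed, because later the error is scaled down and the
  instrument is not.\<close>

lemma instrument_sin_uncorrelated:
  assumes \<beta>: "\<beta> \<in> coeff_matrices G" and y: "y \<notin> insert v (sib G v)"
  shows "(LINT x|model_dist \<beta> N. sin (s * (instrument_form G \<beta> v y \<bullet> x)) * sin (t * (noise_form \<beta> v \<bullet> x)))
    = (LINT x|model_dist \<beta> N. sin (s * (instrument_form G \<beta> v y \<bullet> x))) * (LINT x|model_dist \<beta> N. sin (t * (noise_form \<beta> v \<bullet> x)))"
proof -
  let ?X = "\<lambda>e. noise_form \<beta> v \<bullet> (solution_matrix \<beta> *v e)" and ?Y = "\<lambda>e. instrument_form G \<beta> v y \<bullet> (solution_matrix \<beta> *v e)"
  have "N.indep_var borel ((\<lambda>r. sin (t * r)) \<circ> ?X) borel ((\<lambda>r. sin (s * r)) \<circ> ?Y)"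
    by (rule N.indep_var_compose[OF indep_instrument[OF assms]]) auto
  then have "N.indep_var borel (\<lambda>e. sin (t * ?X e)) borel (\<lambda>e. sin (s * ?Y e))" by (simp add: comp_def)
  then have "(LINT e|N. sin (t * ?X e) * sin (s * ?Y e)) = (LINT e|N. sin (t * ?X e)) * (LINT e|N. sin (s * ?Y e))"
    by (rule N.indep_var_lebesgue_integral) (auto intro!: N.integrable_const_bound[where B = 1])
  then show ?thesis by (simp add: integral_model_dist mult.commute)
qed

lemma instrument_uncorrelated:
  assumes \<beta>: "\<beta> \<in> coeff_matrices G" and y: "y \<notin> insert v (sib G v)"
  shows "(LINT x|model_dist \<beta> N. (instrument_form G \<beta> v y \<bullet> x) * (noise_form \<beta> v \<bullet> x)) = 0"
proof -
  let ?M = "solution_matrix \<beta>"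
  have int: "integrable N (\<lambda>e. c \<bullet> e)" for c
    unfolding inner_vec_def by (auto intro!: integrable_error_component)
  have eq: "c \<bullet> (?M *v e) = (c v* ?M) \<bullet> e" for c e by (simp add: dot_lmul_matrix)
  have "(LINT e|N. (noise_form \<beta> v \<bullet> (?M *v e)) * (instrument_form G \<beta> v y \<bullet> (?M *v e)))
     = (LINT e|N. noise_form \<beta> v \<bullet> (?M *v e)) * (LINT e|N. instrument_form G \<beta> v y \<bullet> (?M *v e))"
    by (rule N.indep_var_lebesgue_integral[OF indep_instrument[OF assms]]) (auto simp: eq int)
  also have "\<dots> = 0" by (simp add: eq mean_error_form)
  finally show ?thesis by (simp add: integral_model_dist mult.commute)
qed

end

section \<open>The influence function\<close>

lemma square_integrable_real:
  "square_integrable M (f :: 'a \<Rightarrow> real) \<longleftrightarrow> f \<in> borel_measurable M \<and> integrable M (\<lambda>x. (f x)\<^sup>2)"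
  by (simp add: square_integrable_def)

lemma square_integrable_mult:
  fixes f g :: "'a \<Rightarrow> real"
  assumes "square_integrable M f" "square_integrable M g"
  shows "integrable M (\<lambda>x. f x * g x)"
proof (rule Bochner_Integration.integrable_bound)
  show "integrable M (\<lambda>x. (f x)\<^sup>2 + (g x)\<^sup>2)" using assms by (simp add: square_integrable_real)
  have "\<bar>a * b\<bar> \<le> a\<^sup>2 + b\<^sup>2" for a b :: real
    using sum_squares_bound[of "\<bar>a\<bar>" "\<bar>b\<bar>"] mult_nonneg_nonneg[OF abs_ge_zero abs_ge_zero, of a b]
    unfolding abs_mult power2_abs by linarith
  then show "AE x in M. norm (f x * g x) \<le> norm ((f x)\<^sup>2 + (g x)\<^sup>2)" by simp
qed (use assms in \<open>auto simp: square_integrable_real\<close>)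

lemma square_integrable_cmult:
  "square_integrable M f \<Longrightarrow> square_integrable M (\<lambda>x. c * f x)" for f :: "'a \<Rightarrow> real"
  by (auto simp: square_integrable_real power_mult_distrib)

lemma square_integrable_add:
  fixes f g :: "'a \<Rightarrow> real"
  assumes "square_integrable M f" "square_integrable M g"
  shows "square_integrable M (\<lambda>x. f x + g x)"
  using assms square_integrable_mult[OF assms] by (auto simp: square_integrable_real power2_sum mult.assoc)

lemma square_integrable_sum:
  fixes f :: "'i \<Rightarrow> 'a \<Rightarrow> real"
  assumes "\<And>i. i \<in> I \<Longrightarrow> square_integrable M (f i)"
  shows "square_integrable M (\<lambda>x. \<Sum>i\<in>I. f i x)"
  using assms
proof (induction I rule: infinite_finite_induct)
  case (insert i I)
  then show ?case by (simp add: square_integrable_add)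
qed (simp_all add: square_integrable_real)

lemma (in prob_space) square_integrable_integrable:
  "square_integrable M f \<Longrightarrow> integrable M f" for f :: "'a \<Rightarrow> real"
  using square_integrable_mult[of M f "\<lambda>_. 1"] by (simp add: square_integrable_real)

text \<open>Here fourth moments enter the influence function itself: its leading terms are products
  of two linear forms.\<close>

lemma (in fourth_moment) square_integrable_bilinear: "square_integrable Q (\<lambda>x. (u \<bullet> x) * (w \<bullet> x))"
  unfolding square_integrable_real
proof
  have u: "\<bar>u \<bullet> x\<bar> \<le> norm u * norm x ^ 1" and w: "\<bar>w \<bullet> x\<bar> \<le> norm w * norm x ^ 1" for x
    using inner_le[OF order_refl, of u x] inner_le[OF order_refl, of w x] by auto
  have 2: "\<bar>(u \<bullet> x) * (w \<bullet> x)\<bar> \<le> norm u * norm w * norm x ^ 2" for x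
    by (rule prod_le2[OF u w]) simp
  show "integrable Q (\<lambda>x. ((u \<bullet> x) * (w \<bullet> x))\<^sup>2)"
  proof (rule integrable_dom[where k = 4])
    show "\<bar>((u \<bullet> x) * (w \<bullet> x))\<^sup>2\<bar> \<le> norm u * norm w * (norm u * norm w) * norm x ^ 4" for x
      unfolding power2_eq_square by (rule prod_le2[OF 2 2]) simp
  qed auto
qed measurable

lemma integral_bilinear_sum:
  fixes M :: "(real^'n) measure" and d w :: "real^'n::finite"
  assumes "\<And>q. q \<notin> J \<Longrightarrow> d $ q = 0" and I: "\<And>q. integrable M (\<lambda>x. x $ q * (w \<bullet> x))"
  shows "(LINT x|M. (d \<bullet> x) * (w \<bullet> x)) = (\<Sum>q\<in>J. d $ q * (LINT x|M. x $ q * (w \<bullet> x)))"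
proof -
  have "(d \<bullet> x) * (w \<bullet> x) = (\<Sum>q\<in>J. d $ q * (x $ q * (w \<bullet> x)))" for x
  proof -
    have "d \<bullet> x = (\<Sum>q\<in>J. d $ q * x $ q)"
      unfolding inner_vec_def inner_real_def using assms(1) by (intro sum.mono_neutral_right) auto
    then show ?thesis by (simp add: sum_distrib_right mult.assoc)
  qed
  then show ?thesis using I by simp
qed

lemma htc_identified_wf:
  fixes G :: "'v::finite mixed_graph"
  assumes "htc_identified G W Y prec"
  shows "wf prec"
proof -
  have "trans prec" "irrefl prec"
    using assms by (auto simp: htc_identified_def strict_linear_order_on_def)
  then show ?thesis by (intro finite_acyclic_wf) (auto simp: acyclic_irrefl)
qed

lemma htc_identified_witness:
  assumes "htc_identified G W Y prec" "u \<in> W" "y \<in> Y u"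
  shows "y \<notin> insert u (sib G u)" and "y \<in> htr G u \<Longrightarrow> y \<in> W \<and> (y, u) \<in> prec"
  using assms by (auto simp: htc_identified_def htc_def)

section \<open>Induction along the ordering\<close>

locale identified =
  fixes G :: "'v::finite mixed_graph" and W :: "'v set" and Y :: "'v \<Rightarrow> 'v set" and prec :: "'v rel"
    and \<beta> :: "real^'v^'v" and N P0 :: "(real^'v) measure"
  assumes G: "directed_mixed_graph G" and id: "htc_identified G W Y prec"
    and \<beta>: "\<beta> \<in> coeff_matrices G" and N: "error_law G N" and P0: "P0 = model_dist \<beta> N"
begin

abbreviation "\<phi> \<equiv> edge_infl G Y prec \<beta> P0"
abbreviation "R \<equiv> row_contrib G Y prec \<beta> P0"
abbreviation "cross u q \<equiv> (LINT x|P0. x $ q * (noise_form \<beta> u \<bullet> x))"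

lemma row_contrib_eq:
  "R u y x = (instrument_form G \<beta> u y \<bullet> x) * (noise_form \<beta> u \<bullet> x)
     - (if y \<in> htr G u then \<Sum>q\<in>pa G y. cross u q * \<phi> y q x else 0)"
  by (simp add: row_contrib_def row_step_def instrument_form_def eps_noise_form[OF \<beta>] inner_axis')

lemma fourth_moment_P0: "square_integrable P0 S \<Longrightarrow> fourth_moment P0 S"
  unfolding P0 by (rule fourth_moment_model_dist[OF G N]) (auto simp: square_integrable_real)

text \<open>The zero score gives access to all facts of the locale that do not mention a score. The
  score of an actual path is supplied by a second interpretation.\<close>

sublocale Q: fourth_moment P0 "\<lambda>_. 0"
  by (rule fourth_moment_P0) (simp add: square_integrable_real)

text \<open>The facts about earlier vertices appear as a hypothesis so that the lemma can serve
  inside the induction that establishes them and again afterwards.\<close>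

lemma row_contrib_moments:
  assumes u: "u \<in> W" "y \<in> Y u"
    and IH: "\<And>y p. y \<in> W \<Longrightarrow> (y, u) \<in> prec \<Longrightarrow> square_integrable P0 (\<phi> y p) \<and> (LINT x|P0. \<phi> y p x) = 0"
  shows "square_integrable P0 (R u y)" and "(LINT x|P0. R u y x) = 0"
proof -
  note y = htc_identified_witness[OF id u]
  have bil: "square_integrable P0 (\<lambda>x. (instrument_form G \<beta> u y \<bullet> x) * (noise_form \<beta> u \<bullet> x))"
    by (rule Q.square_integrable_bilinear)
  have bil0: "(LINT x|P0. (instrument_form G \<beta> u y \<bullet> x) * (noise_form \<beta> u \<bullet> x)) = 0"
    unfolding P0 by (rule instrument_uncorrelated[OF G N \<beta> y(1)])
  have c: "square_integrable P0 (\<lambda>x. (if y \<in> htr G u then \<Sum>q\<in>pa G y. cross u q * \<phi> y q x else 0))"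
    and c0: "(LINT x|P0. (if y \<in> htr G u then \<Sum>q\<in>pa G y. cross u q * \<phi> y q x else 0)) = 0"
  proof -
    show "square_integrable P0 (\<lambda>x. (if y \<in> htr G u then \<Sum>q\<in>pa G y. cross u q * \<phi> y q x else 0))"
      using y(2) IH by (cases "y \<in> htr G u")
        (auto intro!: square_integrable_sum square_integrable_cmult simp: square_integrable_real[of _ "\<lambda>_. 0"])
    show "(LINT x|P0. (if y \<in> htr G u then \<Sum>q\<in>pa G y. cross u q * \<phi> y q x else 0)) = 0"
      using y(2) IH by (cases "y \<in> htr G u") (auto simp: Q.square_integrable_integrable)
  qed
  show "square_integrable P0 (R u y)"
    using square_integrable_add[OF bil square_integrable_cmult[OF c, of "-1"]]
    by (simp add: row_contrib_eq[abs_def])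
  show "(LINT x|P0. R u y x) = 0"
    unfolding row_contrib_eq using bil0 c0
      Q.square_integrable_integrable[OF bil] Q.square_integrable_integrable[OF c] by simp
qed

lemma edge_infl_moments:
  "u \<in> W \<Longrightarrow> square_integrable P0 (\<phi> u p) \<and> (LINT x|P0. \<phi> u p x) = 0"
proof (induction u arbitrary: p rule: wf_induct_rule[OF htc_identified_wf[OF id]])
  case (1 u)
  note row = row_contrib_moments[OF \<open>u \<in> W\<close> _ 1(1)]
  show ?case
    unfolding edge_infl_rec[OF id \<open>u \<in> W\<close>, abs_def] using row
    by (auto intro!: square_integrable_sum square_integrable_cmult simp: Q.square_integrable_integrable)
qed

text \<open>Each witness contributes one linear equation for the increment of column
  \<open>u\<close>, with the row of \<open>A_mat\<close> as coefficients and the score integral of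
  the row contribution on the right. The inverse matrix solves the system, and the induction
  hypothesis accounts for the instruments that are errors of earlier vertices.\<close>

lemma path_derivative:
  assumes path: "model_path G \<beta> N \<beta>s Ns"
    and qmd: "qmd_with_score (\<lambda>\<gamma>. model_dist (\<beta>s \<gamma>) (Ns \<gamma>)) S"
    and inv: "\<forall>u\<in>W. invertible_on (Y u) (pa G u) (A_mat G \<beta> P0 u)"
  shows "u \<in> W \<Longrightarrow> p \<in> pa G u \<Longrightarrow>
    ((\<lambda>\<gamma>. \<beta>s \<gamma> $ p $ u) has_vector_derivative (LINT x|P0. \<phi> u p x * S x)) (at 0)"
proof (induction u arbitrary: p rule: wf_induct_rule[OF htc_identified_wf[OF id]])
  case (1 u)
  note u = \<open>u \<in> W\<close>
  define P where "P = (\<lambda>\<gamma>. model_dist (\<beta>s \<gamma>) (Ns \<gamma>))"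
  have start: "\<beta>s 0 = \<beta>" "Ns 0 = N" and ev: "\<forall>\<^sub>F \<gamma> in at 0. \<beta>s \<gamma> \<in> coeff_matrices G \<and> error_law G (Ns \<gamma>)"
    using path by (auto simp: model_path_def eventually_nhds_conv_at)
  have P_0: "P 0 = P0" by (simp add: P_def start P0)
  have S: "square_integrable P0 S"
    using qmd by (simp add: qmd_with_score_def start P0)
  interpret S: fourth_moment P0 S by (rule fourth_moment_P0[OF S])
  \<comment> \<open>Increments and candidate derivatives are kept for all vertices, since
    instruments bring in the columns of earlier ones. Off the parents both vanish, the increment
    only for \<open>\<gamma>\<close> so small that the path lies in the model.\<close>
  define \<Delta> where "\<Delta> = (\<lambda>u \<gamma>. column u (\<beta>s \<gamma>) - column u \<beta>)"
  define l where "l = (\<lambda>\<gamma>. 1 / (1 + norm (\<Delta> u \<gamma>)))"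
  define D where "D = (\<lambda>u q. if q \<in> pa G u then (LINT x|P0. \<phi> u q x * S x) else 0)"
  let ?n = "\<lambda>\<gamma>. \<bar>\<gamma>\<bar> + l \<gamma> * norm (\<Delta> u \<gamma>)"
  have l: "0 < l \<gamma>" "l \<gamma> \<le> 1" for \<gamma>
    using norm_ge_zero[of "\<Delta> u \<gamma>"] by (simp_all add: l_def add_pos_nonneg)
  have \<Delta>_nth: "\<Delta> w \<gamma> $ q = \<beta>s \<gamma> $ q $ w - \<beta> $ q $ w" for w q \<gamma>
    by (simp add: \<Delta>_def column_def)
  have \<Delta>_out: "\<forall>\<^sub>F \<gamma> in at 0. \<forall>w q. q \<notin> pa G w \<longrightarrow> \<Delta> w \<gamma> $ q = 0"
    using ev by eventually_elim (auto simp: \<Delta>_nth coeff_zero coeff_zero[OF \<beta>])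
  \<comment> \<open>Remainders from earlier vertices are \<open>o(\<gamma>)\<close>. As
    \<open>l \<gamma> \<le> 1\<close> and \<open>\<bar>\<gamma>\<bar> \<le> ?n \<gamma>\<close>,
    they fit the damped scale of the moment equation.\<close>
  have damped: "(\<lambda>\<gamma>. l \<gamma> * f \<gamma>) \<in> o[at 0](?n)" if "f \<in> o[at 0](\<lambda>\<gamma>. \<bar>\<gamma>\<bar>)" for f :: "real \<Rightarrow> real"
  proof (rule landau_o.smallI)
    fix c :: real assume "0 < c"
    from landau_o.smallD[OF that this]
    show "\<forall>\<^sub>F \<gamma> in at 0. norm (l \<gamma> * f \<gamma>) \<le> c * norm (?n \<gamma>)"
    proof eventually_elim
      case (elim \<gamma>)
      have "norm (l \<gamma> * f \<gamma>) \<le> norm (f \<gamma>)"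
        using l[of \<gamma>] by (simp add: abs_mult mult_left_le_one_le)
      also have "\<dots> \<le> c * \<bar>\<gamma>\<bar>" using elim by simp
      also have "\<dots> \<le> c * norm (?n \<gamma>)"
        using \<open>0 < c\<close> l[of \<gamma>] by (intro mult_left_mono) auto
      finally show ?case .
    qed
  qed
  have prev: "(\<lambda>\<gamma>. \<Delta> y \<gamma> $ q - \<gamma> * D y q) \<in> o[at 0](\<lambda>\<gamma>. \<bar>\<gamma>\<bar>)" if y: "y \<in> W" "(y, u) \<in> prec" for y q
  proof (cases "q \<in> pa G y")
    case True
    show ?thesis
      using has_vector_derivative_smallo[OF "1.IH"[OF y(2,1) True]] True
      by (simp add: \<Delta>_nth D_def start)
  next
    case False
    have "\<forall>\<^sub>F \<gamma> in at 0. \<Delta> y \<gamma> $ q - \<gamma> * D y q = 0"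
      using \<Delta>_out by eventually_elim (use False in \<open>simp add: D_def\<close>)
    then show ?thesis by (subst landau_o.small.in_cong[where g = "\<lambda>_. 0"]) auto
  qed
  have bil: "integrable P0 (\<lambda>x. x $ q * (w \<bullet> x))" for q w
    using Q.square_integrable_integrable[OF Q.square_integrable_bilinear[of "axis q 1" w]]
    by (simp add: inner_axis')
  have row: "(\<lambda>\<gamma>. l \<gamma> * ((\<Sum>q\<in>pa G u. A_mat G \<beta> P0 u y q * \<Delta> u \<gamma> $ q) - \<gamma> * (LINT x|P0. R u y x * S x))) \<in> o[at 0](?n)"
    if y: "y \<in> Y u" for y
  proof -
    note wit = htc_identified_witness[OF id u y]
    define z where "z = instrument_form G \<beta> u y"
    define h where "h = noise_form \<beta> u"
    \<comment> \<open>A witness outside \<open>htr G u\<close> is used as the plain variable, which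
      does not involve the coefficients; only an instrument that is an error moves along the
      path.\<close>
    define \<delta> where "\<delta> = (\<lambda>\<gamma>. if y \<in> htr G u then \<Delta> y \<gamma> else 0)"
    define r where "r = (LINT x|P0. (z \<bullet> x) * (h \<bullet> x) * S x)"
    have z: "instrument_form G (\<beta>s \<gamma>) u y = z - \<delta> \<gamma>" and h: "noise_form (\<beta>s \<gamma>) u = h - \<Delta> u \<gamma>" for \<gamma>
      by (simp_all add: z_def h_def \<delta>_def \<Delta>_def instrument_form_def noise_form_def)
    \<comment> \<open>The induction hypothesis with tolerance 1 bounds each entry of the increment
      by \<open>(1 + \<bar>D y q\<bar>) * \<bar>\<gamma>\<bar>\<close>; summing over
      \<open>q\<close> gives \<open>K0\<close>.\<close>
    have "\<exists>K0. \<forall>\<^sub>F \<gamma> in at 0. norm (\<delta> \<gamma>) \<le> K0 * \<bar>\<gamma>\<bar>"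
    proof (cases "y \<in> htr G u")
      case True
      have "\<forall>\<^sub>F \<gamma> in at 0. \<forall>q. norm (\<Delta> y \<gamma> $ q - \<gamma> * D y q) \<le> 1 * norm \<bar>\<gamma>\<bar>"
        by (intro eventually_all_finite landau_o.smallD[OF prev]) (use wit(2)[OF True] in auto)
      then have "\<forall>\<^sub>F \<gamma> in at 0. norm (\<delta> \<gamma>) \<le> (\<Sum>q\<in>UNIV. 1 + \<bar>D y q\<bar>) * \<bar>\<gamma>\<bar>"
      proof eventually_elim
        case (elim \<gamma>)
        have "\<bar>\<Delta> y \<gamma> $ q\<bar> \<le> (1 + \<bar>D y q\<bar>) * \<bar>\<gamma>\<bar>" for q
          using elim[rule_format, of q] abs_triangle_ineq[of "\<Delta> y \<gamma> $ q - \<gamma> * D y q" "\<gamma> * D y q"]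
          by (simp add: algebra_simps abs_mult)
        then have "(\<Sum>q\<in>UNIV. \<bar>\<Delta> y \<gamma> $ q\<bar>) \<le> (\<Sum>q\<in>UNIV. 1 + \<bar>D y q\<bar>) * \<bar>\<gamma>\<bar>"
          unfolding sum_distrib_right by (rule sum_mono)
        then show ?case using norm_le_l1_cart[of "\<Delta> y \<gamma>"] True by (simp add: \<delta>_def)
      qed
      then show ?thesis by blast
    qed (auto simp: \<delta>_def intro!: exI[of _ 0])
    then obtain K0 where K0: "\<forall>\<^sub>F \<gamma> in at 0. norm (\<delta> \<gamma>) \<le> K0 * \<bar>\<gamma>\<bar>" by blast
    have "(\<lambda>\<gamma>. l \<gamma> * (\<gamma> * r - (LINT x|P0. (\<delta> \<gamma> \<bullet> x) * (h \<bullet> x)) - (LINT x|P0. (z \<bullet> x) * (\<Delta> u \<gamma> \<bullet> x)))) \<in> o[at 0](?n)"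
      unfolding l_def r_def
    proof (rule S.moment_equation[OF qmd[folded P_def] P_0 _ _ K0])
      show "(LINT x|P0. sin (s * (z \<bullet> x)) * sin (t * (h \<bullet> x)))
        = (LINT x|P0. sin (s * (z \<bullet> x))) * (LINT x|P0. sin (t * (h \<bullet> x)))" for s t
        unfolding P0 z_def h_def by (rule instrument_sin_uncorrelated[OF G N \<beta> wit(1)])
      show "\<forall>\<^sub>F \<gamma> in at 0. \<forall>s t. (LINT x|P \<gamma>. sin (s * ((z - \<delta> \<gamma>) \<bullet> x)) * sin (t * ((h - \<Delta> u \<gamma>) \<bullet> x)))
        = (LINT x|P \<gamma>. sin (s * ((z - \<delta> \<gamma>) \<bullet> x))) * (LINT x|P \<gamma>. sin (t * ((h - \<Delta> u \<gamma>) \<bullet> x)))"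
        using ev unfolding P_def z[symmetric] h[symmetric]
        by eventually_elim (use instrument_sin_uncorrelated[OF G _ _ wit(1)] in blast)
    qed
    \<comment> \<open>The score integral of the row contribution is \<open>r\<close> minus the
      \<open>cross\<close>-weighted sum of the derivatives \<open>D y q\<close>. The expression is
      therefore the same weighted sum of \<open>\<Delta> y \<gamma> $ q - \<gamma> * D y q\<close>,
      which is small by induction.\<close>
    moreover have "(\<lambda>\<gamma>. l \<gamma> * (\<gamma> * (LINT x|P0. R u y x * S x) - \<gamma> * r + (LINT x|P0. (\<delta> \<gamma> \<bullet> x) * (h \<bullet> x)))) \<in> o[at 0](?n)"
    proof (rule damped)
      have zh: "integrable P0 (\<lambda>x. (z \<bullet> x) * (h \<bullet> x) * S x)"
        by (rule square_integrable_mult[OF Q.square_integrable_bilinear S])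
      show "(\<lambda>\<gamma>. \<gamma> * (LINT x|P0. R u y x * S x) - \<gamma> * r + (LINT x|P0. (\<delta> \<gamma> \<bullet> x) * (h \<bullet> x))) \<in> o[at 0](\<lambda>\<gamma>. \<bar>\<gamma>\<bar>)"
      proof (cases "y \<in> htr G u")
        case True
        note yW = wit(2)[OF True]
        have \<phi>S: "integrable P0 (\<lambda>x. \<phi> y q x * S x)" for q
          using yW edge_infl_moments by (intro square_integrable_mult[OF _ S]) auto
        have "(LINT x|P0. R u y x * S x) = (LINT x|P0. (z \<bullet> x) * (h \<bullet> x) * S x
            - (\<Sum>q\<in>pa G y. cross u q * (\<phi> y q x * S x)))"
          using True by (intro Bochner_Integration.integral_cong)
            (auto simp: row_contrib_eq z_def h_def left_diff_distrib sum_distrib_right mult.assoc)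
        also have "\<dots> = r - (\<Sum>q\<in>pa G y. cross u q * D y q)"
          using zh \<phi>S by (simp add: r_def D_def)
        finally have R: "(LINT x|P0. R u y x * S x) = r - (\<Sum>q\<in>pa G y. cross u q * D y q)" .
        have "\<forall>\<^sub>F \<gamma> in at 0. (\<Sum>q\<in>pa G y. cross u q * (\<Delta> y \<gamma> $ q - \<gamma> * D y q))
           = \<gamma> * (LINT x|P0. R u y x * S x) - \<gamma> * r + (LINT x|P0. (\<delta> \<gamma> \<bullet> x) * (h \<bullet> x))"
          using \<Delta>_out
        proof eventually_elim
          case (elim \<gamma>)
          have "(LINT x|P0. (\<delta> \<gamma> \<bullet> x) * (h \<bullet> x)) = (\<Sum>q\<in>pa G y. \<Delta> y \<gamma> $ q * cross u q)"
            using integral_bilinear_sum[of "pa G y" "\<Delta> y \<gamma>" P0 h, OF _ bil] elim True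
            by (simp add: \<delta>_def h_def)
          then show ?case unfolding R
            by (simp add: left_diff_distrib right_diff_distrib sum_subtractf sum_distrib_left mult_ac)
        qed
        moreover have "(\<lambda>\<gamma>. \<Sum>q\<in>pa G y. cross u q * (\<Delta> y \<gamma> $ q - \<gamma> * D y q)) \<in> o[at 0](\<lambda>\<gamma>. \<bar>\<gamma>\<bar>)"
          using prev yW by (intro big_sum_in_smallo) auto
        ultimately show ?thesis by (rule landau_o.small.in_cong[THEN iffD1])
      next
        case False
        have "(LINT x|P0. R u y x * S x) = r" using False by (simp add: r_def row_contrib_eq z_def h_def)
        then show ?thesis using False by (simp add: \<delta>_def)
      qed
    qed
    \<comment> \<open>In the sum of the two estimates the terms with \<open>r\<close> and with
      \<open>\<delta>\<close> cancel, leaving the increment of column \<open>u\<close> against the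
      row contribution.\<close>
    ultimately have "(\<lambda>\<gamma>. l \<gamma> * (\<gamma> * (LINT x|P0. R u y x * S x) - \<gamma> * r + (LINT x|P0. (\<delta> \<gamma> \<bullet> x) * (h \<bullet> x)))
        + l \<gamma> * (\<gamma> * r - (LINT x|P0. (\<delta> \<gamma> \<bullet> x) * (h \<bullet> x)) - (LINT x|P0. (z \<bullet> x) * (\<Delta> u \<gamma> \<bullet> x)))) \<in> o[at 0](?n)"
      by (intro sum_in_smallo)
    then have o: "(\<lambda>\<gamma>. - (l \<gamma> * (\<gamma> * (LINT x|P0. R u y x * S x) - (LINT x|P0. (z \<bullet> x) * (\<Delta> u \<gamma> \<bullet> x))))) \<in> o[at 0](?n)"
      unfolding landau_o.small.uminus_in_iff by (simp add: right_diff_distrib distrib_left)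
    have "\<forall>\<^sub>F \<gamma> in at 0. - (l \<gamma> * (\<gamma> * (LINT x|P0. R u y x * S x) - (LINT x|P0. (z \<bullet> x) * (\<Delta> u \<gamma> \<bullet> x))))
       = l \<gamma> * ((\<Sum>q\<in>pa G u. A_mat G \<beta> P0 u y q * \<Delta> u \<gamma> $ q) - \<gamma> * (LINT x|P0. R u y x * S x))"
      using \<Delta>_out
    proof eventually_elim
      case (elim \<gamma>)
      have A: "A_mat G \<beta> P0 u y q = (LINT x|P0. x $ q * (z \<bullet> x))" for q
        by (simp add: A_mat_def instrument_form[OF \<beta>] z_def mult.commute)
      have "(LINT x|P0. (z \<bullet> x) * (\<Delta> u \<gamma> \<bullet> x)) = (\<Sum>q\<in>pa G u. A_mat G \<beta> P0 u y q * \<Delta> u \<gamma> $ q)"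
        using integral_bilinear_sum[of "pa G u" "\<Delta> u \<gamma>" P0 z, OF _ bil] elim by (simp add: A mult.commute)
      then show ?case by (simp add: right_diff_distrib)
    qed
    then show ?thesis using o by (rule landau_o.small.in_cong[THEN iffD1])
  qed
  let ?B = "matrix_inv_on (Y u) (pa G u) (A_mat G \<beta> P0 u)"
  have B: "inverse_pair_on (Y u) (pa G u) (A_mat G \<beta> P0 u) ?B"
    using inv u unfolding invertible_on_def matrix_inv_on_def by (metis someI_ex)
  have comp: "(\<lambda>\<gamma>. l \<gamma> * (\<Delta> u \<gamma> $ q - \<gamma> * (\<chi> q. D u q) $ q)) \<in> o[at 0](?n)" for q
  proof (cases "q \<in> pa G u")
    case True
    have RS: "integrable P0 (\<lambda>x. R u y x * S x)" if "y \<in> Y u" for y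
      using row_contrib_moments(1)[OF u that] edge_infl_moments by (intro square_integrable_mult[OF _ S]) auto
    have D_eq: "D u q = (\<Sum>y\<in>Y u. ?B q y * (LINT x|P0. R u y x * S x))"
    proof -
      have "(LINT x|P0. \<phi> u q x * S x) = (LINT x|P0. (\<Sum>y\<in>Y u. ?B q y * (R u y x * S x)))"
        by (simp add: edge_infl_rec[OF id u] sum_distrib_right mult.assoc)
      then show ?thesis using RS True by (simp add: D_def)
    qed
    \<comment> \<open>The inverse is applied from the left, with both sums finite, so the increment
      of each edge is a fixed linear combination of the row equations and inherits their
      error.\<close>
    have \<Delta>_eq: "\<Delta> u \<gamma> $ q = (\<Sum>y\<in>Y u. ?B q y * (\<Sum>q'\<in>pa G u. A_mat G \<beta> P0 u y q' * \<Delta> u \<gamma> $ q'))" for \<gamma>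
    proof -
      have "(\<Sum>y\<in>Y u. ?B q y * (\<Sum>q'\<in>pa G u. A_mat G \<beta> P0 u y q' * \<Delta> u \<gamma> $ q'))
          = (\<Sum>q'\<in>pa G u. (\<Sum>y\<in>Y u. ?B q y * A_mat G \<beta> P0 u y q') * \<Delta> u \<gamma> $ q')"
        unfolding sum_distrib_left sum_distrib_right mult.assoc by (rule sum.swap)
      also have "\<dots> = (\<Sum>q'\<in>pa G u. (if q = q' then 1 else 0) * \<Delta> u \<gamma> $ q')"
        using B True by (intro sum.cong) (auto simp: inverse_pair_on_def)
      also have "\<dots> = \<Delta> u \<gamma> $ q" using True by (simp add: if_distrib[of "\<lambda>c. c * _"] cong: if_cong)
      finally show ?thesis by simp
    qed
    have "l \<gamma> * (\<Delta> u \<gamma> $ q - \<gamma> * (\<chi> q. D u q) $ q) = (\<Sum>y\<in>Y u. ?B q y * (l \<gamma> *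
        ((\<Sum>q\<in>pa G u. A_mat G \<beta> P0 u y q * \<Delta> u \<gamma> $ q) - \<gamma> * (LINT x|P0. R u y x * S x))))" for \<gamma>
    proof -
      have lin: "a * ((\<Sum>y\<in>Y u. b y * t y) - c * (\<Sum>y\<in>Y u. b y * s y)) = (\<Sum>y\<in>Y u. b y * (a * (t y - c * s y)))"
        for a c :: real and b t s
        by (simp add: sum_distrib_left right_diff_distrib sum_subtractf mult_ac)
      show ?thesis unfolding vec_lambda_beta D_eq by (subst \<Delta>_eq) (rule lin)
    qed
    moreover have "(\<lambda>\<gamma>. \<Sum>y\<in>Y u. ?B q y * (l \<gamma> * ((\<Sum>q\<in>pa G u. A_mat G \<beta> P0 u y q * \<Delta> u \<gamma> $ q)
        - \<gamma> * (LINT x|P0. R u y x * S x)))) \<in> o[at 0](?n)"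
      by (rule big_sum_in_smallo, subst cmult_in_smallo_iff, rule disjI2, erule row)
    ultimately show ?thesis by (simp only:)
  next
    case False
    have "\<forall>\<^sub>F \<gamma> in at 0. l \<gamma> * (\<Delta> u \<gamma> $ q - \<gamma> * (\<chi> q. D u q) $ q) = 0"
      using \<Delta>_out by eventually_elim (use False in \<open>simp add: D_def\<close>)
    then show ?thesis by (subst landau_o.small.in_cong[where g = "\<lambda>_. 0"]) auto
  qed
  have "(\<Delta> u has_vector_derivative (\<chi> q. D u q)) (at 0)"
    by (rule has_vector_derivative_damped) (use comp in \<open>auto simp: l_def \<Delta>_def start\<close>)
  then have "((\<lambda>\<gamma>. \<Delta> u \<gamma> $ p) has_vector_derivative D u p) (at 0)"
    using bounded_linear.has_vector_derivative[OF bounded_linear_vec_nth, of "\<Delta> u" "\<chi> q. D u q" "at 0" p] by simp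
  then have "((\<lambda>\<gamma>. \<Delta> u \<gamma> $ p + \<beta> $ p $ u) has_vector_derivative D u p) (at 0)"
    by (simp add: has_vector_derivative_add_const)
  then show ?case using \<open>p \<in> pa G u\<close> by (simp add: \<Delta>_nth D_def)
qed

lemma edge_infl_influence_function:
  assumes "\<forall>u\<in>W. invertible_on (Y u) (pa G u) (A_mat G \<beta> P0 u)" "u \<in> W" "p \<in> pa G u"
  shows "influence_function G \<beta> N (\<lambda>b. b $ p $ u) (\<phi> u p)"
  unfolding influence_function_def P0[symmetric]
proof (intro conjI allI impI)
  note mom = edge_infl_moments[OF assms(2), of p]
  show "has_bochner_integral P0 (\<phi> u p) 0"
    using mom Q.square_integrable_integrable by (auto simp: has_bochner_integral_iff)
  show "square_integrable P0 (\<phi> u p)" using mom by blast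
  fix \<beta>s Ns S
  assume "model_path G \<beta> N \<beta>s Ns \<and> qmd_with_score (\<lambda>\<gamma>. model_dist (\<beta>s \<gamma>) (Ns \<gamma>)) S"
  then have "((\<lambda>\<gamma>. \<beta>s \<gamma> $ p $ u) has_vector_derivative (LINT x|P0. \<phi> u p x * S x)) (at 0)"
    by (intro path_derivative[OF _ _ assms]) auto
  then show "((\<lambda>\<gamma>. \<beta>s \<gamma> $ p $ u) has_vector_derivative (LINT x|P0. S x *\<^sub>R \<phi> u p x)) (at 0)"
    by (simp add: mult.commute)
qed

end

text \<open>A coefficient vector indexed by the parents is encoded as a vector over all vertices
  that is zero elsewhere. As a finite sum of multiples of axis vectors it inherits mean and
  derivative by linearity, and square-integrability because its squared norm is the sum of the
  squared entries.\<close>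

lemma influence_function_vec:
  fixes G :: "'v::finite mixed_graph" and J :: "'n::finite set" and \<phi> :: "'n \<Rightarrow> real^'v \<Rightarrow> real"
  assumes IF: "\<And>p. p \<in> J \<Longrightarrow> influence_function G \<beta> N (\<psi> p) (\<phi> p)"
  shows "influence_function G \<beta> N (\<lambda>b. \<chi> p. if p \<in> J then \<psi> p b else 0) (\<lambda>x. \<chi> p. if p \<in> J then \<phi> p x else 0)"
proof -
  have decomp: "(\<chi> p. if p \<in> J then a p else 0) = (\<Sum>p\<in>J. a p *\<^sub>R axis p 1)" for a :: "'n \<Rightarrow> real"
    by (simp add: vec_eq_iff axis_def if_distrib[of "\<lambda>c. _ * c"] cong: if_cong)
  have norm2: "(norm (\<Sum>p\<in>J. a p *\<^sub>R axis p 1 :: real^'n))\<^sup>2 = (\<Sum>p\<in>J. (a p)\<^sup>2)" for a :: "'n \<Rightarrow> real"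
    unfolding decomp[symmetric] power2_norm_eq_inner
    by (simp add: inner_vec_def power2_eq_square if_distrib[of "\<lambda>c. c * _"] sum.If_cases)
  have sq: "square_integrable (model_dist \<beta> N) (\<phi> p)" if "p \<in> J" for p
    using IF[OF that] by (simp add: influence_function_def)
  show ?thesis
    unfolding influence_function_def decomp
  proof (intro conjI allI impI)
    have "has_bochner_integral (model_dist \<beta> N) (\<lambda>x. \<Sum>p\<in>J. \<phi> p x *\<^sub>R axis p 1 :: real^'n) (\<Sum>p\<in>J. 0 *\<^sub>R axis p 1)"
      using IF by (intro has_bochner_integral_sum has_bochner_integral_scaleR_left) (auto simp: influence_function_def)
    then show "has_bochner_integral (model_dist \<beta> N) (\<lambda>x. \<Sum>p\<in>J. \<phi> p x *\<^sub>R axis p 1 :: real^'n) 0" by simp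
    show "square_integrable (model_dist \<beta> N) (\<lambda>x. \<Sum>p\<in>J. \<phi> p x *\<^sub>R axis p 1 :: real^'n)"
      unfolding square_integrable_def norm2 using sq
      by (auto simp: square_integrable_real intro!: borel_measurable_sum borel_measurable_scaleR)
    fix \<beta>s Ns S
    assume path: "model_path G \<beta> N \<beta>s Ns \<and> qmd_with_score (\<lambda>\<gamma>. model_dist (\<beta>s \<gamma>) (Ns \<gamma>)) S"
    then have S: "square_integrable (model_dist \<beta> N) S"
      by (auto simp: model_path_def qmd_with_score_def)
    have int: "(LINT x|model_dist \<beta> N. S x *\<^sub>R (\<Sum>p\<in>J. \<phi> p x *\<^sub>R axis p 1 :: real^'n))
        = (\<Sum>p\<in>J. (LINT x|model_dist \<beta> N. S x *\<^sub>R \<phi> p x) *\<^sub>R axis p 1)"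
      using square_integrable_mult[OF S sq]
      by (simp add: scaleR_sum_right)
    show "((\<lambda>\<gamma>. \<Sum>p\<in>J. \<psi> p (\<beta>s \<gamma>) *\<^sub>R axis p 1 :: real^'n) has_vector_derivative
        (LINT x|model_dist \<beta> N. S x *\<^sub>R (\<Sum>p\<in>J. \<phi> p x *\<^sub>R axis p 1))) (at 0)"
      unfolding int using IF path
      by (intro has_vector_derivative_sum bounded_linear.has_vector_derivative[OF bounded_linear_scaleR_left])
         (auto simp: influence_function_def)
  qed
qed

theorem theorem7:
  fixes G :: "'v::finite mixed_graph"
    and W :: "'v set" and Y :: "'v \<Rightarrow> 'v set" and prec :: "'v rel"
    and \<beta> :: "real^'v^'v" and N P0 :: "(real^'v) measure" and v :: 'v
  assumes "directed_mixed_graph G"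
    and "htc_identified G W Y prec"
    and "\<beta> \<in> coeff_matrices G"
    and "error_law G N"
    and "P0 = model_dist \<beta> N"
    and "\<forall>u\<in>W. invertible_on (Y u) (pa G u) (A_mat G \<beta> P0 u)"
    and "v \<in> W"
  shows "influence_function G \<beta> N (\<lambda>b. \<chi> p. if p \<in> pa G v then b $ p $ v else 0)
           (\<lambda>x. \<chi> p. if p \<in> pa G v
              then \<Sum>y\<in>Y v. matrix_inv_on (Y v) (pa G v) (A_mat G \<beta> P0 v) p y
                              * row_contrib G Y prec \<beta> P0 v y x
              else 0)
       \<and> (\<forall>p\<in>pa G v. influence_function G \<beta> N (\<lambda>b. b $ p $ v) (edge_infl G Y prec \<beta> P0 v p)
           \<and> edge_infl G Y prec \<beta> P0 v p =
               (\<lambda>x. \<Sum>y\<in>Y v. matrix_inv_on (Y v) (pa G v) (A_mat G \<beta> P0 v) p y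
                              * row_contrib G Y prec \<beta> P0 v y x))"
proof -
  interpret identified G W Y prec \<beta> N P0
    using assms(1-5) by unfold_locales
  have edge: "influence_function G \<beta> N (\<lambda>b. b $ p $ v) (edge_infl G Y prec \<beta> P0 v p)" if "p \<in> pa G v" for p
    using edge_infl_influence_function[OF assms(6,7) that] .
  note rec = edge_infl_rec[OF assms(2,7), of \<beta> P0]
  have "influence_function G \<beta> N (\<lambda>b. \<chi> p. if p \<in> pa G v then b $ p $ v else 0)
     (\<lambda>x. \<chi> p. if p \<in> pa G v then edge_infl G Y prec \<beta> P0 v p x else 0)"
    by (rule influence_function_vec) (rule edge)
  then show ?thesis unfolding rec[symmetric] using edge by simp
qed

end
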